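(* Let $d\ge1$ and let $\mathcal{X}\subseteq\{x\in\mathbb{R}^d:\|x\|\le1\}$ be finite. There is an absolute constant $C>0$ such that for the linear model class $\mathcal{M}_{\mathsf{Lin}}$ with the $L_1$ estimation loss, $$\textsf{p-dec}^{\mathrm{LDP}}_\varepsilon(\mathcal{M}_{\mathsf{Lin}})\le C\sqrt d\,\varepsilon\qquad\text{for all }\varepsilon\in[0,1].$$
   Context: Observations are $z=(x,y)\in\mathcal{Z}=\mathcal{X}\times\{-1,1\}$. $\mathcal{M}_{\mathsf{Lin}}$ consists of all distributions $M\in\Delta(\mathcal{Z})$ for which there exist a covariate distribution $\nu_M\in\Delta(\mathcal{X})$ and $\theta^M\in\mathbb{R}^d$ with $\|\theta^M\|\le1$ such that $x\sim\nu_M$ and, given $x$, $y\in\{-1,1\}$ has mean $\langle x,\theta^M\rangle$. The decision space is $\Pi=\{\theta\in\mathbb{R}^d:\|\theta\|\le1\}$ and the loss is $L_1(M,\theta)=\mathbb{E}_{x\sim\nu_M}|\langle x,\theta-\theta^M\rangle|$. $\mathcal{L}$ is the set of functions $\mathcal{Z}\to[0,1]$, $D_\ell(P,Q)=|\mathbb{E}_P\ell-\mathbb{E}_Q\ell|$. Private PAC-DEC (statistical case, models do not depend on the decision): $\textsf{p-dec}^{\mathrm{LDP}}_\varepsilon(\mathcal{M},\overline M)=\inf_{p\in\Delta(\Pi),q\in\Delta(\mathcal{L})}\sup_{M\in\mathcal{M}}\{\mathbb{E}_{\pi\sim p}L(M,\pi):\mathbb{E}_{\ell\sim q}D_\ell^2(M,\overline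 M)\le\varepsilon^2\}$ and $\textsf{p-dec}^{\mathrm{LDP}}_\varepsilon(\mathcal{M})=\sup_{\overline M\in\mathrm{co}(\mathcal{M})}\textsf{p-dec}^{\mathrm{LDP}}_\varepsilon(\mathcal{M},\overline M)$. *)

theory Defs
  imports "HOL-Probability.Probability"
begin

text \<open>Vectors of R^d are represented as functions nat => real vanishing outside {..<d};
  this lets the dimension d be quantified inside the formula, so that the constant C
  can be absolute (independent of d).\<close>

type_synonym vec = "nat \<Rightarrow> real"
type_synonym obs = "vec \<times> real"

definition rvec :: "nat \<Rightarrow> vec set" where
  "rvec d = {x. \<forall>i\<ge>d. x i = 0}"

definition ip :: "nat \<Rightarrow> vec \<Rightarrow> vec \<Rightarrow> real" where
  "ip d x y = (\<Sum>i<d. x i * y i)"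

definition vnorm :: "nat \<Rightarrow> vec \<Rightarrow> real" where
  "vnorm d x = sqrt (ip d x x)"

definition Pi_dec :: "nat \<Rightarrow> vec set" where
  "Pi_dec d = {\<theta> \<in> rvec d. vnorm d \<theta> \<le> 1}"

definition Zsp :: "vec set \<Rightarrow> obs set" where
  "Zsp X = X \<times> {-1, 1}"

definition cond_mean :: "obs pmf \<Rightarrow> vec \<Rightarrow> real" where
  "cond_mean M x = measure_pmf.expectation (cond_pmf M {z. fst z = x}) snd"

definition is_param :: "nat \<Rightarrow> obs pmf \<Rightarrow> vec \<Rightarrow> bool" where
  "is_param d M \<theta> \<longleftrightarrow> \<theta> \<in> Pi_dec d \<and>
     (\<forall>x \<in> set_pmf (map_pmf fst M). cond_mean M x = ip d x \<theta>)"

definition M_Lin :: "nat \<Rightarrow> vec set \<Rightarrow> obs pmf set" where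
  "M_Lin d X = {M. set_pmf M \<subseteq> Zsp X \<and> (\<exists>\<theta>. is_param d M \<theta>)}"

definition theta_of :: "nat \<Rightarrow> obs pmf \<Rightarrow> vec" where
  "theta_of d M = (SOME \<theta>. is_param d M \<theta>)"

definition L1 :: "nat \<Rightarrow> obs pmf \<Rightarrow> vec \<Rightarrow> real" where
  "L1 d M \<theta> = measure_pmf.expectation (map_pmf fst M) (\<lambda>x. \<bar>ip d x (\<theta> - theta_of d M)\<bar>)"

definition Lfun :: "(obs \<Rightarrow> real) set" where
  "Lfun = {l. \<forall>z. 0 \<le> l z \<and> l z \<le> 1}"

definition Dl :: "(obs \<Rightarrow> real) \<Rightarrow> obs pmf \<Rightarrow> obs pmf \<Rightarrow> real" where
  "Dl l P Q = \<bar>measure_pmf.expectation P l - measure_pmf.expectation Q l\<bar>"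

definition co_pmf :: "'a pmf set \<Rightarrow> 'a pmf set" where
  "co_pmf S = {join_pmf W | W. finite (set_pmf W) \<and> set_pmf W \<subseteq> S}"

text \<open>Private PAC-DEC at reference model Mb (sup over an empty set taken as 0).\<close>
definition pdec_at :: "nat \<Rightarrow> vec set \<Rightarrow> real \<Rightarrow> obs pmf \<Rightarrow> real" where
  "pdec_at d X \<epsilon> Mb = Inf {Sup (insert 0
       {measure_pmf.expectation p (L1 d M) | M. M \<in> M_Lin d X \<and>
          measure_pmf.expectation q (\<lambda>l. (Dl l M Mb)\<^sup>2) \<le> \<epsilon>\<^sup>2})
     | p q. set_pmf p \<subseteq> Pi_dec d \<and> set_pmf q \<subseteq> Lfun}"

definition pdec :: "nat \<Rightarrow> vec set \<Rightarrow> real \<Rightarrow> real" where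
  "pdec d X \<epsilon> = Sup (insert 0 (pdec_at d X \<epsilon> ` co_pmf (M_Lin d X)))"

end

theory Submission
  imports Defs
begin

text \<open>
  Let \<open>N\<close> be the dual norm of a quadratic form \<open>Q\<close> with
  \<open>Q \<approx> \<Sum>\<nu>(x) \<langle>x, \<cdot>\<rangle>\<^sup>2 / N(x) + (100 \<epsilon>)\<^sup>2 |\<cdot>|\<^sup>2\<close>, where \<open>\<nu>\<close> is the covariate
  marginal of the reference model: a regularised \<open>L\<^sub>1\<close> Lewis change of density. In a
  \<open>Q\<close>-orthonormal basis \<open>e\<close> the vectors \<open>w(x) = (\<langle>x, e\<^sub>i\<rangle> / N(x))\<^sub>i\<close> are unit vectors.
  The decision is the least squares solution with weights \<open>1 / N\<close> for the reference model.
  Queries \<open>y g(x)\<close>, \<open>\<langle>x, \<theta>\<^sub>0\<rangle> g(x)\<close>, with \<open>g\<close> a random bounded sketch of \<open>w\<close>, control the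
  normal equations up to \<open>O(\<epsilon>)\<close>; queries \<open>100 \<epsilon> N(x) g(x)\<close>, with \<open>g\<close> a sketch of \<open>w \<otimes> w\<close>,
  show that the information matrix of the model is within \<open>1/4\<close>, in Frobenius norm,
  of that of the reference.
  Hence \<open>\<theta>\<^sup>M - \<theta>\<^sub>0\<close> has \<open>Q\<close>-norm \<open>O(\<epsilon>)\<close>, and the loss is at most
  \<open>sqrt (E N(x)) sqrt (E \<langle>x, \<theta>\<^sup>M - \<theta>\<^sub>0\<rangle>\<^sup>2 / N(x))\<close>, where \<open>E N(x) = O(d)\<close> is a trace.
\<close>

subsection \<open>Bounded random sketches\<close>

text \<open>Finite supports make every \<open>f\<close> integrable, so the mixture rule holds for
  all \<open>f\<close> at once; it lets one distribution serve several families of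
  functions.\<close>

lemma pmf_mix:
  fixes p q :: "'a pmf" and u :: real
  assumes "finite (set_pmf p)" "finite (set_pmf q)" "0 \<le> u" "u \<le> 1"
  obtains r where "finite (set_pmf r)" "set_pmf r \<subseteq> set_pmf p \<union> set_pmf q"
    "\<And>f :: 'a \<Rightarrow> real. measure_pmf.expectation r f =
       u * measure_pmf.expectation p f + (1 - u) * measure_pmf.expectation q f"
proof -
  define r where "r = bernoulli_pmf u \<bind> (\<lambda>b. if b then p else q)"
  have sub: "set_pmf r \<subseteq> set_pmf p \<union> set_pmf q"
    unfolding r_def by (auto simp: set_bind_pmf split: if_splits)
  moreover from sub have "finite (set_pmf r)" by (rule finite_subset) (use assms in auto)
  moreover have "measure_pmf.expectation r f =
       u * measure_pmf.expectation p f + (1 - u) * measure_pmf.expectation q f" for f :: "'a \<Rightarrow> real"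
  proof -
    have "measure_pmf.expectation r f =
       (\<Sum>b\<in>(UNIV::bool set). pmf (bernoulli_pmf u) b *\<^sub>R measure_pmf.expectation (if b then p else q) f)"
      unfolding r_def by (rule pmf_expectation_bind) (use assms in auto)
    also have "\<dots> = u * measure_pmf.expectation p f + (1 - u) * measure_pmf.expectation q f"
      using assms by (simp add: UNIV_bool)
    finally show ?thesis .
  qed
  ultimately show ?thesis using that by blast
qed

text \<open>The rows of \<open>r\<close> list all sign vectors of length \<open>D\<close>: these are
  the second moment and the Khintchine fourth moment of a Rademacher sum, times \<open>m\<close>.
  Adding a coordinate with both signs cancels the odd powers.\<close>

lemma rademacher_system:
  "\<exists>m>0. \<exists>r :: nat \<Rightarrow> nat \<Rightarrow> real. \<forall>w :: nat \<Rightarrow> real.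
     (\<Sum>n<m. (\<Sum>i<D. w i * r n i)\<^sup>2) = real m * (\<Sum>i<D. (w i)\<^sup>2) \<and>
     (\<Sum>n<m. (\<Sum>i<D. w i * r n i) ^ 4) \<le> 3 * real m * (\<Sum>i<D. (w i)\<^sup>2)\<^sup>2"
proof (induction D)
  case 0
  show ?case by (intro exI[of _ "1::nat"] conjI) auto
next
  case (Suc D)
  then obtain m :: nat and r :: "nat \<Rightarrow> nat \<Rightarrow> real" where m: "m > 0" and
    sq: "\<And>w. (\<Sum>n<m. (\<Sum>i<D. w i * r n i)\<^sup>2) = real m * (\<Sum>i<D. (w i)\<^sup>2)" and
    fr: "\<And>w. (\<Sum>n<m. (\<Sum>i<D. w i * r n i) ^ 4) \<le> 3 * real m * (\<Sum>i<D. (w i)\<^sup>2)\<^sup>2"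
    by blast
  \<comment> \<open>Rows below \<open>m\<close> are extended by 1; the rows from \<open>m\<close> on
    repeat them with -1.\<close>
  define r' where "r' = (\<lambda>n i. if i < D then r (n mod m) i else if n < m then 1 else (-1::real))"
  have split: "(\<Sum>n<2*m. F n) = (\<Sum>n<m. F n + F (m + n))" for F :: "nat \<Rightarrow> real"
  proof -
    have "(\<Sum>n<m+k. F n) = (\<Sum>n<m. F n) + (\<Sum>n<k. F (m + n))" for k
      by (induction k) simp_all
    from this[of m] show ?thesis by (simp only: sum.distrib mult_2)
  qed
  show ?case
  proof (intro exI[of _ "2*m"] exI[of _ r'] conjI allI)
    show "0 < 2 * m" using m by simp
    fix w :: "nat \<Rightarrow> real"
    define h where "h n = (\<Sum>i<D. w i * r n i)" for n
    define W where "W = (\<Sum>i<D. (w i)\<^sup>2)"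
    have lo: "(\<Sum>i<Suc D. w i * r' n i) = h n + w D" if "n < m" for n
      using that by (simp add: r'_def h_def)
    have hi: "(\<Sum>i<Suc D. w i * r' (m + n) i) = h n - w D" if "n < m" for n
      using that by (simp add: r'_def h_def)
    have "(\<Sum>n<2*m. (\<Sum>i<Suc D. w i * r' n i)\<^sup>2) = (\<Sum>n<m. (h n + w D)\<^sup>2 + (h n - w D)\<^sup>2)"
      unfolding split by (intro sum.cong refl) (use lo hi in simp)
    also have "\<dots> = (\<Sum>n<m. 2 * (h n)\<^sup>2 + 2 * (w D)\<^sup>2)"
      by (intro sum.cong refl) (simp add: power2_eq_square algebra_simps)
    also have "\<dots> = real (2*m) * (W + (w D)\<^sup>2)"
      using sq[of w] unfolding h_def[symmetric] W_def[symmetric]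
      by (simp add: sum.distrib flip: sum_distrib_left) (simp add: algebra_simps)
    finally show "(\<Sum>n<2*m. (\<Sum>i<Suc D. w i * r' n i)\<^sup>2) = real (2*m) * (\<Sum>i<Suc D. (w i)\<^sup>2)"
      by (simp add: W_def)
    have "(\<Sum>n<2*m. (\<Sum>i<Suc D. w i * r' n i)^4) = (\<Sum>n<m. (h n + w D)^4 + (h n - w D)^4)"
      unfolding split by (intro sum.cong refl) (use lo hi in simp)
    also have "\<dots> = (\<Sum>n<m. 2 * (h n)^4 + (12 * (w D)\<^sup>2) * (h n)\<^sup>2 + 2 * (w D)^4)"
      by (intro sum.cong refl) (simp add: power2_eq_square power4_eq_xxxx algebra_simps)
    also have "\<dots> = 2 * (\<Sum>n<m. (h n)^4) + 12 * (w D)\<^sup>2 * (real m * W) + 2 * real m * (w D)^4"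
      using sq[of w] unfolding h_def[symmetric] W_def[symmetric]
      by (simp add: sum.distrib flip: sum_distrib_left)
    \<comment> \<open>Raising 2 to 6 in the last term completes the square.\<close>
    also have "\<dots> \<le> 2 * (3 * real m * W\<^sup>2) + 12 * (w D)\<^sup>2 * (real m * W) + 6 * real m * (w D)^4"
      proof -
      have "0 \<le> real m * w D ^ 4" by simp
      then show ?thesis using fr[of w, folded h_def W_def] by linarith
    qed
    also have "\<dots> = 3 * real (2*m) * (W + (w D)\<^sup>2)\<^sup>2"
      by (simp add: power2_eq_square power4_eq_xxxx algebra_simps)
    finally show "(\<Sum>n<2*m. (\<Sum>i<Suc D. w i * r' n i)^4) \<le> 3 * real (2*m) * (\<Sum>i<Suc D. (w i)\<^sup>2)\<^sup>2"
      by (simp add: W_def)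
  qed
qed

text \<open>A distribution over functions with values in \<open>[-1, 1]\<close> is to dominate, up to the factor
  \<open>t\<close>, the Gram kernel of \<open>w\<close>. Truncating the Rademacher embedding of \<open>w\<close> leaves a
  remainder of norm at most \<open>1/2\<close>, to which the same can be applied; so any \<open>t\<close> can be
  replaced by \<open>24 + t / 2\<close>.\<close>

definition sketchable :: "'x set \<Rightarrow> real \<Rightarrow> bool" where
  "sketchable X t \<longleftrightarrow> (\<forall>(D::nat) (w :: 'x \<Rightarrow> nat \<Rightarrow> real). (\<forall>x\<in>X. (\<Sum>i<D. (w x i)\<^sup>2) \<le> 1) \<longrightarrow>
     (\<exists>p :: ('x \<Rightarrow> real) pmf. finite (set_pmf p) \<and> (\<forall>g\<in>set_pmf p. \<forall>x. \<bar>g x\<bar> \<le> 1) \<and>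
        (\<forall>\<alpha>. (\<Sum>i<D. (\<Sum>x\<in>X. \<alpha> x * w x i)\<^sup>2) \<le> t * measure_pmf.expectation p (\<lambda>g. (\<Sum>x\<in>X. \<alpha> x * g x)\<^sup>2))))"

lemma sketchable_mono:
  assumes X: "sketchable X s" and "s \<le> t" shows "sketchable X t"
  unfolding sketchable_def
proof (intro allI impI)
  fix D :: nat and w :: "'a \<Rightarrow> nat \<Rightarrow> real"
  let ?E = "\<lambda>p \<alpha>. measure_pmf.expectation p (\<lambda>g. (\<Sum>x\<in>X. \<alpha> x * g x)\<^sup>2)"
  assume "\<forall>x\<in>X. (\<Sum>i<D. (w x i)\<^sup>2) \<le> 1"
  from X[unfolded sketchable_def, THEN spec, THEN spec, THEN mp, OF this]
  obtain p where p: "finite (set_pmf p)" "\<forall>g\<in>set_pmf p. \<forall>x. \<bar>g x\<bar> \<le> 1"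
    and bd: "\<forall>\<alpha>. (\<Sum>i<D. (\<Sum>x\<in>X. \<alpha> x * w x i)\<^sup>2) \<le> s * ?E p \<alpha>"
    by (elim exE conjE)
  have "s * ?E p \<alpha> \<le> t * ?E p \<alpha>" for \<alpha>
    by (intro mult_right_mono assms integral_nonneg) auto
  with bd have "\<forall>\<alpha>. (\<Sum>i<D. (\<Sum>x\<in>X. \<alpha> x * w x i)\<^sup>2) \<le> t * ?E p \<alpha>"
    by (blast intro: order_trans)
  with p show "\<exists>p. finite (set_pmf p) \<and> (\<forall>g\<in>set_pmf p. \<forall>x. \<bar>g x\<bar> \<le> 1) \<and>
      (\<forall>\<alpha>. (\<Sum>i<D. (\<Sum>x\<in>X. \<alpha> x * w x i)\<^sup>2) \<le> t * ?E p \<alpha>)"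
    by blast
qed

text \<open>A uniformly sampled point evaluation loses one factor \<open>card X\<close> by
  Cauchy-Schwarz and another by the sampling. Any finite starting value will do, since iterated
  halving removes it.\<close>

lemma sketchable_base:
  assumes "finite X" "X \<noteq> {}" shows "sketchable X ((real (card X))\<^sup>2)"
  unfolding sketchable_def
proof (intro allI impI)
  fix D :: nat and w :: "'a \<Rightarrow> nat \<Rightarrow> real"
  assume w: "\<forall>x\<in>X. (\<Sum>i<D. (w x i)\<^sup>2) \<le> 1"
  define e where "e = (\<lambda>(y::'a) x. of_bool (x = y) :: real)"
  define p where "p = map_pmf e (pmf_of_set X)"
  have "(\<Sum>i<D. (\<Sum>x\<in>X. \<alpha> x * w x i)\<^sup>2) \<le> (real (card X))\<^sup>2 * measure_pmf.expectation p (\<lambda>g. (\<Sum>x\<in>X. \<alpha> x * g x)\<^sup>2)"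
    for \<alpha> :: "'a \<Rightarrow> real"
  proof -
    have "(\<Sum>i<D. (\<Sum>x\<in>X. \<alpha> x * w x i)\<^sup>2) \<le> (\<Sum>i<D. real (card X) * (\<Sum>x\<in>X. (\<alpha> x * w x i)\<^sup>2))"
    proof (intro sum_mono)
      fix i
      show "(\<Sum>x\<in>X. \<alpha> x * w x i)\<^sup>2 \<le> real (card X) * (\<Sum>x\<in>X. (\<alpha> x * w x i)\<^sup>2)"
        using Cauchy_Schwarz_ineq_sum[of "\<lambda>_. 1" "\<lambda>x. \<alpha> x * w x i" X] by simp
    qed
    also have "\<dots> = real (card X) * (\<Sum>x\<in>X. (\<alpha> x)\<^sup>2 * (\<Sum>i<D. (w x i)\<^sup>2))"
      by (simp add: sum_distrib_left power_mult_distrib sum.swap[of _ X "{..<D}"])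
    also have "\<dots> \<le> real (card X) * (\<Sum>x\<in>X. (\<alpha> x)\<^sup>2 * 1)"
      using w by (intro mult_left_mono sum_mono) auto
    also have "\<dots> = (real (card X))\<^sup>2 * measure_pmf.expectation p (\<lambda>g. (\<Sum>x\<in>X. \<alpha> x * g x)\<^sup>2)"
    proof -
      have "measure_pmf.expectation p (\<lambda>g. (\<Sum>x\<in>X. \<alpha> x * g x)\<^sup>2) = (\<Sum>y\<in>X. (\<alpha> y)\<^sup>2) / real (card X)"
        using assms by (simp add: p_def integral_pmf_of_set e_def of_bool_def if_distrib cong: if_cong)
      then show ?thesis using assms by (simp add: power2_eq_square)
    qed
    finally show ?thesis .
  qed
  then show "\<exists>p :: ('a \<Rightarrow> real) pmf. finite (set_pmf p) \<and> (\<forall>g\<in>set_pmf p. \<forall>x. \<bar>g x\<bar> \<le> 1) \<and>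
        (\<forall>\<alpha>. (\<Sum>i<D. (\<Sum>x\<in>X. \<alpha> x * w x i)\<^sup>2) \<le> (real (card X))\<^sup>2 * measure_pmf.expectation p (\<lambda>g. (\<Sum>x\<in>X. \<alpha> x * g x)\<^sup>2))"
    using assms by (intro exI[of _ p]) (auto simp: p_def e_def)
qed

lemma sketchable_step:
  assumes t: "sketchable X t" "t \<ge> 0" shows "sketchable X (24 + t / 2)"
  unfolding sketchable_def
proof (intro allI impI)
  fix D :: nat and w :: "'a \<Rightarrow> nat \<Rightarrow> real"
  assume w: "\<forall>x\<in>X. (\<Sum>i<D. (w x i)\<^sup>2) \<le> 1"
  obtain m :: nat and r :: "nat \<Rightarrow> nat \<Rightarrow> real" where m: "m > 0" and
    sq: "\<And>w. (\<Sum>n<m. (\<Sum>i<D. w i * r n i)\<^sup>2) = real m * (\<Sum>i<D. (w i)\<^sup>2)" and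
    fr: "\<And>w. (\<Sum>n<m. (\<Sum>i<D. w i * r n i) ^ 4) \<le> 3 * real m * (\<Sum>i<D. (w i)\<^sup>2)\<^sup>2"
    using rademacher_system[of D] by blast
  define h where "h x n = (\<Sum>i<D. w x i * r n i)" for x n
  \<comment> \<open>The threshold 12 is tuned to the fourth moment 3: the part above it has mean
    square at most \<open>3 / 12 = 1 / 4\<close>, so its double \<open>w'\<close> has norm at most 1
    and the hypothesis on \<open>t\<close> applies.\<close>
  define lo where "lo x n = (if (h x n)\<^sup>2 \<le> 12 then h x n else 0)" for x n
  define hi where "hi x n = h x n - lo x n" for x n
  have hi_sq: "(hi x n)\<^sup>2 \<le> (h x n)^4 / 12" for x n
  proof (cases "(h x n)\<^sup>2 \<le> 12")
    case False
    then have "12 * (h x n)\<^sup>2 \<le> (h x n)\<^sup>2 * (h x n)\<^sup>2" by (intro mult_right_mono) auto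
    then show ?thesis using False by (simp add: hi_def lo_def power2_eq_square power4_eq_xxxx)
  qed (simp add: hi_def lo_def)
  define w' where "w' x n = 2 / sqrt (real m) * hi x n" for x n
  have "(\<Sum>n<m. (w' x n)\<^sup>2) \<le> 1" if x: "x \<in> X" for x
  proof -
    have "(\<Sum>n<m. (w' x n)\<^sup>2) = 4 / real m * (\<Sum>n<m. (hi x n)\<^sup>2)"
      by (simp add: w'_def power_mult_distrib power_divide sum_distrib_left)
    also have "(\<Sum>n<m. (hi x n)\<^sup>2) \<le> (\<Sum>n<m. (h x n)^4) / 12"
      unfolding sum_divide_distrib by (intro sum_mono hi_sq)
    also have "(\<Sum>n<m. (h x n)^4) \<le> 3 * real m * (\<Sum>i<D. (w x i)\<^sup>2)\<^sup>2"
      unfolding h_def by (rule fr)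
    also have "(\<Sum>i<D. (w x i)\<^sup>2)\<^sup>2 \<le> 1"
      using w x by (intro power_le_one sum_nonneg) auto
    finally show ?thesis using m by (simp add: field_simps)
  qed
  then obtain p1 :: "('a \<Rightarrow> real) pmf" where p1: "finite (set_pmf p1)" "\<forall>g\<in>set_pmf p1. \<forall>x. \<bar>g x\<bar> \<le> 1" and
    p1_bd: "\<And>\<alpha>. (\<Sum>n<m. (\<Sum>x\<in>X. \<alpha> x * w' x n)\<^sup>2) \<le> t * measure_pmf.expectation p1 (\<lambda>g. (\<Sum>x\<in>X. \<alpha> x * g x)\<^sup>2)"
    using t(1) unfolding sketchable_def by blast
  define p0 where "p0 = map_pmf (\<lambda>n x. lo x n / sqrt 12) (pmf_of_set {..<m})"
  have ne: "{..<m} \<noteq> {}" using m by auto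
  have p0: "finite (set_pmf p0)" "\<forall>g\<in>set_pmf p0. \<forall>x. \<bar>g x\<bar> \<le> 1"
  proof -
    show "finite (set_pmf p0)" by (simp add: p0_def ne)
    have "\<bar>lo x n\<bar> \<le> sqrt 12" for x n
      by (auto simp: lo_def real_le_rsqrt)
    then show "\<forall>g\<in>set_pmf p0. \<forall>x. \<bar>g x\<bar> \<le> 1"
      by (auto simp: p0_def ne)
  qed
  \<comment> \<open>Splitting \<open>h\<close> into \<open>lo\<close> and \<open>hi\<close> costs a
    factor 2. The first part then carries \<open>2 * 12\<close>, having been divided by
    \<open>sqrt 12\<close>, and the second \<open>2 * t / 4\<close>; \<open>u\<close> shares the
    mass in this proportion.\<close>
  define u where "u = 24 / (24 + t / 2)"
  have u: "0 \<le> u" "u \<le> 1" "(24 + t/2) * u = 24" "(24 + t/2) * (1 - u) = t/2"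
    using t(2) by (auto simp: u_def field_simps)
  obtain p where p: "finite (set_pmf p)" "set_pmf p \<subseteq> set_pmf p0 \<union> set_pmf p1"
    and pE: "\<And>f. measure_pmf.expectation p f =
       u * measure_pmf.expectation p0 f + (1 - u) * measure_pmf.expectation p1 f"
    using pmf_mix[OF p0(1) p1(1) u(1,2)] by blast
  have "(\<Sum>i<D. (\<Sum>x\<in>X. \<alpha> x * w x i)\<^sup>2) \<le> (24 + t / 2) * measure_pmf.expectation p (\<lambda>g. (\<Sum>x\<in>X. \<alpha> x * g x)\<^sup>2)"
    for \<alpha> :: "'a \<Rightarrow> real"
  proof -
    let ?S = "\<lambda>g. (\<Sum>x\<in>X. \<alpha> x * g x)\<^sup>2"
    have e0: "measure_pmf.expectation p0 ?S = (\<Sum>n<m. ?S (\<lambda>x. lo x n)) / (12 * real m)"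
    proof -
      have scale: "?S (\<lambda>x. lo x n / sqrt 12) = ?S (\<lambda>x. lo x n) / 12" for n
        by (simp add: power_divide flip: sum_divide_distrib)
      have "measure_pmf.expectation p0 ?S = (\<Sum>n<m. ?S (\<lambda>x. lo x n / sqrt 12)) / real m"
        using ne by (simp add: p0_def integral_pmf_of_set)
      then show ?thesis by (simp only: scale) (simp flip: sum_divide_distrib)
    qed
    have e1: "(\<Sum>n<m. ?S (\<lambda>x. hi x n)) = real m / 4 * (\<Sum>n<m. ?S (\<lambda>x. w' x n))"
    proof -
      have "?S (\<lambda>x. w' x n) = 4 / real m * ?S (\<lambda>x. hi x n)" for n
      proof -
        have "(\<Sum>x\<in>X. \<alpha> x * w' x n) = 2 / sqrt (real m) * (\<Sum>x\<in>X. \<alpha> x * hi x n)"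
          by (simp add: w'_def sum_distrib_left algebra_simps)
        then show ?thesis by (simp add: power_mult_distrib power_divide)
      qed
      then show ?thesis using m by (simp only: flip: sum_distrib_left) simp
    qed
    have "real m * (\<Sum>i<D. (\<Sum>x\<in>X. \<alpha> x * w x i)\<^sup>2) = (\<Sum>n<m. (\<Sum>i<D. (\<Sum>x\<in>X. \<alpha> x * w x i) * r n i)\<^sup>2)"
      by (rule sq[symmetric])
    also have "\<dots> = (\<Sum>n<m. ?S (\<lambda>x. h x n))"
    proof (intro sum.cong refl arg_cong[where f = "\<lambda>z. z\<^sup>2"])
      fix n
      show "(\<Sum>i<D. (\<Sum>x\<in>X. \<alpha> x * w x i) * r n i) = (\<Sum>x\<in>X. \<alpha> x * h x n)"
        by (simp add: h_def sum_distrib_left sum_distrib_right mult.assoc sum.swap[of _ X "{..<D}"])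
    qed
    also have "\<dots> \<le> (\<Sum>n<m. 2 * ?S (\<lambda>x. lo x n) + 2 * ?S (\<lambda>x. hi x n))"
    proof (intro sum_mono)
      fix n
      have "(\<Sum>x\<in>X. \<alpha> x * h x n) = (\<Sum>x\<in>X. \<alpha> x * lo x n) + (\<Sum>x\<in>X. \<alpha> x * hi x n)"
        by (simp add: hi_def algebra_simps flip: sum.distrib)
      moreover have "(a + b)\<^sup>2 \<le> 2 * a\<^sup>2 + 2 * b\<^sup>2" for a b :: real
        using zero_le_power2[of "a - b"] by (simp add: power2_eq_square algebra_simps)
      ultimately show "?S (\<lambda>x. h x n) \<le> 2 * ?S (\<lambda>x. lo x n) + 2 * ?S (\<lambda>x. hi x n)" by simp
    qed
    also have "\<dots> = real m * (24 * measure_pmf.expectation p0 ?S + (\<Sum>n<m. ?S (\<lambda>x. w' x n)) / 2)"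
      using m e0 e1 by (simp add: sum.distrib algebra_simps flip: sum_distrib_left)
    also have "\<dots> \<le> real m * (24 * measure_pmf.expectation p0 ?S + t * measure_pmf.expectation p1 ?S / 2)"
      using p1_bd[of \<alpha>] by (intro mult_left_mono) auto
    also have "\<dots> = real m * ((24 + t/2) * measure_pmf.expectation p ?S)"
    proof -
      have "(24 + t/2) * measure_pmf.expectation p ?S =
        (24 + t/2) * u * measure_pmf.expectation p0 ?S + (24 + t/2) * (1 - u) * measure_pmf.expectation p1 ?S"
        unfolding pE by (simp only: distrib_left mult.assoc)
      then show ?thesis unfolding u(3,4) by simp
    qed
    finally show ?thesis using m by simp
  qed
  then show "\<exists>p :: ('a \<Rightarrow> real) pmf. finite (set_pmf p) \<and> (\<forall>g\<in>set_pmf p. \<forall>x. \<bar>g x\<bar> \<le> 1) \<and>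
        (\<forall>\<alpha>. (\<Sum>i<D. (\<Sum>x\<in>X. \<alpha> x * w x i)\<^sup>2) \<le> (24 + t / 2) * measure_pmf.expectation p (\<lambda>g. (\<Sum>x\<in>X. \<alpha> x * g x)\<^sup>2))"
    using p p0 p1 by (intro exI[of _ p]) auto
qed

text \<open>The map from \<open>t\<close> to \<open>24 + t / 2\<close> has fixed point 48 and halves
  the excess over it. The number of steps depends on \<open>X\<close>, the resulting constant does
  not.\<close>

lemma sketchable_49:
  assumes "finite X" "X \<noteq> {}" shows "sketchable X 49"
proof -
  define s where "s = (real (card X))\<^sup>2"
  have "sketchable X (48 + s / 2^n)" for n
  proof (induction n)
    case 0
    show ?case by (rule sketchable_mono[OF sketchable_base[OF assms]]) (simp add: s_def)
  next
    case (Suc n)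
    have "sketchable X (24 + (48 + s / 2^n) / 2)"
      by (rule sketchable_step[OF Suc]) (simp add: s_def)
    then show ?case by (simp add: field_simps)
  qed
  moreover obtain n where "s < 2^n"
    using real_arch_pow[of 2 s] by auto
  then have "48 + s / 2^n \<le> 49" by (simp add: field_simps)
  ultimately show ?thesis by (rule sketchable_mono)
qed

text \<open>Reindexing extends the result to arbitrary finite index sets, such as the pairs
  \<open>(i, j)\<close> that index \<open>w \<otimes> w\<close>.\<close>

lemma sketch:
  fixes w :: "'x \<Rightarrow> 'i \<Rightarrow> real"
  assumes X: "finite X" "X \<noteq> {}" and I: "finite I" and w: "\<And>x. x \<in> X \<Longrightarrow> (\<Sum>i\<in>I. (w x i)\<^sup>2) \<le> 1"
  obtains p :: "('x \<Rightarrow> real) pmf" where "finite (set_pmf p)" "\<And>g x. g \<in> set_pmf p \<Longrightarrow> \<bar>g x\<bar> \<le> 1"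
    "\<And>\<alpha>. (\<Sum>i\<in>I. (\<Sum>x\<in>X. \<alpha> x * w x i)\<^sup>2) \<le> 49 * measure_pmf.expectation p (\<lambda>g. (\<Sum>x\<in>X. \<alpha> x * g x)\<^sup>2)"
proof -
  obtain h where h: "bij_betw h {..<card I} I"
    using ex_bij_betw_nat_finite[OF I] by (auto simp: atLeast0LessThan)
  have re: "(\<Sum>i\<in>I. F i) = (\<Sum>n<card I. F (h n))" for F :: "'i \<Rightarrow> real"
    using sum.reindex_bij_betw[OF h, of F] by simp
  have "\<forall>x\<in>X. (\<Sum>i<card I. (w x (h i))\<^sup>2) \<le> 1"
    using w by (simp add: re)
  from sketchable_49[OF X, unfolded sketchable_def, THEN spec, of "card I", THEN spec,
      of "\<lambda>x n. w x (h n)", THEN mp, OF this]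
  obtain p where "finite (set_pmf p)" "\<forall>g\<in>set_pmf p. \<forall>x. \<bar>g x\<bar> \<le> 1"
    "\<forall>\<alpha>. (\<Sum>i<card I. (\<Sum>x\<in>X. \<alpha> x * w x (h i))\<^sup>2) \<le> 49 * measure_pmf.expectation p (\<lambda>g. (\<Sum>x\<in>X. \<alpha> x * g x)\<^sup>2)"
    by (elim exE conjE)
  then show ?thesis using that[of p] by (simp add: re)
qed

subsection \<open>Balanced weights\<close>

lemma ip_commute: "ip d x y = ip d y x"
  by (simp add: ip_def mult.commute)

lemma ip_lincomb: "ip d x (\<lambda>i. s * u i + t * v i) = s * ip d x u + t * ip d x v"
  by (simp add: ip_def algebra_simps sum.distrib sum_distrib_left)

lemma ip_diff: "ip d x (u - v) = ip d x u - ip d x v"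
  by (simp add: ip_def algebra_simps sum_subtractf)

lemma ip_sum: "ip d x (\<lambda>k. \<Sum>i<n. c i * f i k) = (\<Sum>i<n. c i * ip d x (f i))"
  by (simp add: ip_def sum_distrib_left algebra_simps sum.swap[of _ "{..<d}" "{..<n}"])

lemma ip_nonneg: "0 \<le> ip d x x"
  by (simp add: ip_def sum_nonneg)

lemma ip_eq_0_iff: "x \<in> rvec d \<Longrightarrow> ip d x x = 0 \<longleftrightarrow> x = (\<lambda>_. 0)"
  unfolding ip_def rvec_def fun_eq_iff by (auto simp: sum_nonneg_eq_0_iff) (meson lessThan_iff not_le)

lemma ip_cauchy_schwarz: "(ip d x y)\<^sup>2 \<le> ip d x x * ip d y y"
  unfolding ip_def using Cauchy_Schwarz_ineq_sum[of x y "{..<d}"] by (simp add: power2_eq_square)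

text \<open>Coordinates are added one at a time: the unit vector \<open>b\<close> at position
  \<open>n\<close>, made orthogonal to the earlier \<open>e i\<close>, keeps \<open>z n = 1\<close>.
  Combinations carry explicit coefficients, even 1 and 0, to match the shape of
  \<open>lin\<close>.\<close>

lemma gram_schmidt:
  fixes Q :: "vec \<Rightarrow> vec \<Rightarrow> real"
  assumes sym: "\<And>u v. Q u v = Q v u"
    and lin: "\<And>s t u v w. Q (\<lambda>i. s * u i + t * v i) w = s * Q u w + t * Q v w"
    and pos: "\<And>u. u \<in> rvec d \<Longrightarrow> u \<noteq> (\<lambda>_. 0) \<Longrightarrow> 0 < Q u u"
    and "n \<le> d"
  shows "\<exists>e. (\<forall>i<n. e i \<in> rvec n) \<and> (\<forall>i<n. \<forall>j<n. Q (e i) (e j) = of_bool (i = j)) \<and>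
    (\<forall>u\<in>rvec n. u = (\<lambda>k. \<Sum>i<n. Q u (e i) * e i k))"
  using \<open>n \<le> d\<close>
proof (induction n)
  case 0
  show ?case by (auto simp: rvec_def)
next
  case (Suc n)
  then obtain e where e: "\<And>i. i < n \<Longrightarrow> e i \<in> rvec n"
    and orth: "\<And>i j. i < n \<Longrightarrow> j < n \<Longrightarrow> Q (e i) (e j) = of_bool (i = j)"
    and expand: "\<And>u. u \<in> rvec n \<Longrightarrow> u = (\<lambda>k. \<Sum>i<n. Q u (e i) * e i k)"
    by fastforce
  have lin0: "Q (\<lambda>_. 0) w = 0" for w
    using lin[of 0 "\<lambda>_. 0" 0 "\<lambda>_. 0" w] by simp
  have lin_sum: "Q (\<lambda>k. \<Sum>i<m. c i * f i k) w = (\<Sum>i<m. c i * Q (f i) w)"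
    for m :: nat and c f w
  proof (induction m)
    case (Suc m)
    show ?case using lin[of 1 "\<lambda>k. \<Sum>i<m. c i * f i k" "c m" "f m" w] Suc by simp
  qed (simp add: lin0)
  define b :: vec where "b = (\<lambda>k. of_bool (k = n))"
  define z :: vec where "z = (\<lambda>k. 1 * b k + (-1) * (\<Sum>i<n. Q b (e i) * e i k))"
  have e_n: "e i k = 0" if "i < n" "n \<le> k" for i k
    using e[OF that(1)] that(2) by (simp add: rvec_def)
  have z_n: "z n = 1" by (simp add: z_def b_def e_n)
  have z_in: "z \<in> rvec (Suc n)" by (auto simp: rvec_def z_def b_def e_n)
  have ze: "Q z (e j) = 0" if "j < n" for j
    unfolding z_def lin lin_sum using that by (simp add: orth if_distrib cong: if_cong)
  have Qz: "Q z z > 0"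
  proof (rule pos)
    show "z \<in> rvec d" using z_in Suc.prems by (auto simp: rvec_def)
    show "z \<noteq> (\<lambda>_. 0)" using z_n by force
  qed
  define f where "f = (\<lambda>k. (1 / sqrt (Q z z)) * z k + 0 * z k)"
  have Qf: "Q f w = Q z w / sqrt (Q z z)" for w unfolding f_def lin by simp
  have Qff: "Q f f = 1" unfolding Qf sym[of z f] using Qz by simp
  define e' where "e' = e(n := f)"
  have "u = (\<lambda>k. \<Sum>i<Suc n. Q u (e' i) * e' i k)" if u: "u \<in> rvec (Suc n)" for u
  proof -
    \<comment> \<open>Removing \<open>u n\<close> copies of \<open>z\<close> clears coordinate
      \<open>n\<close>, so the induction hypothesis expands \<open>u0\<close>. As \<open>u0\<close>
      is then \<open>Q\<close>-orthogonal to \<open>z\<close>, the coefficient of \<open>f\<close>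
      can be read off.\<close>
    define u0 where "u0 = (\<lambda>k. 1 * u k + (- u n) * z k)"
    have u0: "u0 \<in> rvec n"
      unfolding rvec_def
    proof (intro CollectI allI impI)
      fix i assume "n \<le> i"
      then show "u0 i = 0"
        using u z_in z_n by (cases "i = n") (auto simp: u0_def rvec_def)
    qed
    have Qu0: "Q u0 w = Q u w - u n * Q z w" for w unfolding u0_def lin by simp
    have "Q u0 z = (\<Sum>i<n. Q u0 (e i) * Q (e i) z)"
      by (subst expand[OF u0]) (simp only: lin_sum)
    also have "\<dots> = 0" by (simp add: sym[of _ z] ze)
    finally have Quz: "Q u z = u n * Q z z" using Qu0[of z] by simp
    have "u k = (\<Sum>i<Suc n. Q u (e' i) * e' i k)" for k
    proof -
      have "u k = u0 k + u n * z k" by (simp add: u0_def)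
      also have "u0 k = (\<Sum>i<n. Q u (e i) * e i k)"
        using fun_cong[OF expand[OF u0], of k] by (simp add: Qu0 ze)
      also have "u n * z k = Q u f * f k"
      proof -
        have "Q u f = u n * Q z z / sqrt (Q z z)" by (simp only: sym[of u f] Qf sym[of z u] Quz)
        moreover have "f k = z k / sqrt (Q z z)" by (simp add: f_def)
        ultimately show ?thesis using Qz by simp
      qed
      finally show ?thesis by (simp add: e'_def)
    qed
    then show ?thesis by blast
  qed
  moreover have "e' i \<in> rvec (Suc n)" if "i < Suc n" for i
    using e[of i] z_in that by (auto simp: e'_def f_def rvec_def)
  moreover have "Q (e' i) (e' j) = of_bool (i = j)" if "i < Suc n" "j < Suc n" for i j
    using that orth[of i j] Qz by (auto simp: e'_def Qff Qf ze sym[of _ f] less_Suc_eq)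
  ultimately show ?case by (intro exI[of _ e']) blast
qed

section \<open>Weighted quadratic forms and their dual norms\<close>

text \<open>Every quadratic form of the weight iteration is of this shape, so that it is
  determined by the weights.\<close>

definition wform :: "nat \<Rightarrow> real \<Rightarrow> vec set \<Rightarrow> (vec \<Rightarrow> real) \<Rightarrow> vec \<Rightarrow> vec \<Rightarrow> real" where
  "wform d lam X a u v = (\<Sum>x\<in>X. a x * ip d x u * ip d x v) + lam * ip d u v"

definition wbasis :: "nat \<Rightarrow> real \<Rightarrow> vec set \<Rightarrow> (vec \<Rightarrow> real) \<Rightarrow> nat \<Rightarrow> vec" where
  "wbasis d lam X a = (SOME e. (\<forall>i<d. e i \<in> rvec d) \<and>
     (\<forall>i<d. \<forall>j<d. wform d lam X a (e i) (e j) = of_bool (i = j)) \<and>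
     (\<forall>u\<in>rvec d. u = (\<lambda>k. \<Sum>i<d. wform d lam X a u (e i) * e i k)))"

text \<open>The dual norm of the form, that is, the maximum of \<open>\<bar>ip d x u\<bar>\<close>
  over \<open>u\<close> in \<open>rvec d\<close> with form at most 1, computed in an orthonormal
  basis.\<close>

definition wdual :: "nat \<Rightarrow> real \<Rightarrow> vec set \<Rightarrow> (vec \<Rightarrow> real) \<Rightarrow> vec \<Rightarrow> real" where
  "wdual d lam X a x = sqrt (\<Sum>i<d. (ip d x (wbasis d lam X a i))\<^sup>2)"

lemma wform_commute: "wform d lam X a u v = wform d lam X a v u"
  by (simp add: wform_def ip_commute[of d u v] mult_ac)

lemma wform_self: "wform d lam X a u u = (\<Sum>x\<in>X. a x * (ip d x u)\<^sup>2) + lam * ip d u u"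
  by (simp add: wform_def power2_eq_square mult_ac)

lemma wform_lincomb:
  "wform d lam X a (\<lambda>i. s * u i + t * v i) w = s * wform d lam X a u w + t * wform d lam X a v w"
  by (simp add: wform_def ip_lincomb ip_commute[of d _ w] algebra_simps sum.distrib sum_distrib_left)

lemma wform_sum:
  fixes n :: nat
  shows "wform d lam X a (\<lambda>k. \<Sum>i<n. c i * f i k) w = (\<Sum>i<n. c i * wform d lam X a (f i) w)"
proof (induction n)
  case 0
  show ?case using wform_lincomb[of d lam X a 0 "\<lambda>_. 0" 0 "\<lambda>_. 0" w] by simp
next
  case (Suc n)
  show ?case
    using wform_lincomb[of d lam X a 1 "\<lambda>k. \<Sum>i<n. c i * f i k" "c n" "f n" w] Suc by simp
qed

lemma wform_mono:
  assumes "\<And>x. x \<in> X \<Longrightarrow> a x \<le> b x"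
  shows "wform d lam X a u u \<le> wform d lam X b u u"
  unfolding wform_self using assms by (intro add_right_mono sum_mono mult_right_mono) auto

lemma wform_lower:
  assumes "\<And>x. x \<in> X \<Longrightarrow> 0 \<le> a x" shows "lam * ip d u u \<le> wform d lam X a u u"
  unfolding wform_self using assms by (simp add: sum_nonneg)

text \<open>The positive regulariser makes the form definite on \<open>rvec d\<close> even if all
  weights vanish, so an orthonormal basis exists.\<close>

locale weighted_form =
  fixes d :: nat and lam :: real and X :: "vec set" and a :: "vec \<Rightarrow> real"
  assumes lam_pos: "0 < lam" and a_nonneg: "\<And>x. x \<in> X \<Longrightarrow> 0 \<le> a x"
begin

abbreviation "Q \<equiv> wform d lam X a"
abbreviation "e \<equiv> wbasis d lam X a"
abbreviation "N \<equiv> wdual d lam X a"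

lemma wform_nonneg: "0 \<le> Q u u"
  by (rule order_trans[OF _ wform_lower]) (use lam_pos ip_nonneg[of d u] a_nonneg in auto)

lemma basis:
  shows basis_in: "i < d \<Longrightarrow> e i \<in> rvec d"
    and basis_orth: "i < d \<Longrightarrow> j < d \<Longrightarrow> Q (e i) (e j) = of_bool (i = j)"
    and basis_expand: "u \<in> rvec d \<Longrightarrow> u = (\<lambda>k. \<Sum>i<d. Q u (e i) * e i k)"
proof -
  have "0 < Q u u" if "u \<in> rvec d" "u \<noteq> (\<lambda>_. 0)" for u
  proof -
    have "0 < lam * ip d u u"
      using that lam_pos ip_nonneg[of d u] ip_eq_0_iff[of u d] by (simp add: less_le)
    also have "\<dots> \<le> Q u u" by (rule wform_lower[OF a_nonneg])
    finally show ?thesis .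
  qed
  from gram_schmidt[of Q, OF wform_commute wform_lincomb this order_refl]
  have *: "(\<forall>i<d. e i \<in> rvec d) \<and> (\<forall>i<d. \<forall>j<d. Q (e i) (e j) = of_bool (i = j)) \<and>
     (\<forall>u\<in>rvec d. u = (\<lambda>k. \<Sum>i<d. Q u (e i) * e i k))"
    unfolding wbasis_def by (rule someI_ex)
  show "i < d \<Longrightarrow> e i \<in> rvec d" "i < d \<Longrightarrow> j < d \<Longrightarrow> Q (e i) (e j) = of_bool (i = j)"
    "u \<in> rvec d \<Longrightarrow> u = (\<lambda>k. \<Sum>i<d. Q u (e i) * e i k)"
    using * by blast+
qed

lemma ip_expand: "u \<in> rvec d \<Longrightarrow> ip d x u = (\<Sum>i<d. Q u (e i) * ip d x (e i))"
  by (subst basis_expand) (simp_all only: ip_sum)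

lemma parseval:
  assumes "u \<in> rvec d" shows "Q u u = (\<Sum>i<d. (Q u (e i))\<^sup>2)"
proof -
  have "Q u u = Q (\<lambda>k. \<Sum>i<d. Q u (e i) * e i k) u"
    using basis_expand[OF assms] by (rule arg_cong[where f = "\<lambda>z. Q z u"])
  also have "\<dots> = (\<Sum>i<d. (Q u (e i))\<^sup>2)"
    unfolding wform_sum by (simp add: wform_commute[of d lam X a _ u] power2_eq_square)
  finally show ?thesis .
qed

lemma wdual_nonneg: "0 \<le> N x"
  by (simp add: wdual_def sum_nonneg)

lemma wdual_sq: "(N x)\<^sup>2 = (\<Sum>i<d. (ip d x (e i))\<^sup>2)"
  by (simp add: wdual_def sum_nonneg)

lemma dual_bound:
  assumes "u \<in> rvec d" shows "(ip d x u)\<^sup>2 \<le> (N x)\<^sup>2 * Q u u"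
  unfolding ip_expand[OF assms] parseval[OF assms] wdual_sq
  using Cauchy_Schwarz_ineq_sum[of "\<lambda>i. Q u (e i)" "\<lambda>i. ip d x (e i)" "{..<d}"]
  by (simp add: mult.commute)

text \<open>\<open>y\<close> is the Riesz representer of \<open>ip d x\<close> for the inner product
  \<open>Q\<close>, the case of equality in \<open>dual_bound\<close>.\<close>

lemma dual_attained:
  obtains y where "y \<in> rvec d" "ip d x y = (N x)\<^sup>2" "Q y y = (N x)\<^sup>2"
proof -
  define y where "y = (\<lambda>k. \<Sum>i<d. ip d x (e i) * e i k)"
  have y: "y \<in> rvec d" using basis_in by (auto simp: y_def rvec_def)
  have xy: "ip d x y = (N x)\<^sup>2" unfolding y_def ip_sum wdual_sq by (simp add: power2_eq_square)
  have "Q y (e j) = ip d x (e j)" if "j < d" for j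
  proof -
    show ?thesis unfolding y_def wform_sum using that by (simp add: basis_orth if_distrib cong: if_cong)
  qed
  then have "Q y y = (N x)\<^sup>2" unfolding parseval[OF y] wdual_sq by simp
  with y xy show ?thesis using that by blast
qed

text \<open>\<open>Q\<close> dominates \<open>lam\<close> times the Euclidean form, so its dual is
  dominated by the Euclidean one; the Riesz representer is the test vector. This is what keeps
  queries scaled by \<open>N\<close> bounded.\<close>

lemma wdual_le_norm: "lam * (N x)\<^sup>2 \<le> ip d x x"
proof -
  obtain y where y: "y \<in> rvec d" "ip d x y = (N x)\<^sup>2" "Q y y = (N x)\<^sup>2"
    by (rule dual_attained)
  have "lam * ((N x)\<^sup>2)\<^sup>2 = lam * (ip d x y)\<^sup>2" using y by simp
  also have "\<dots> \<le> lam * (ip d x x * ip d y y)"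
    using lam_pos ip_cauchy_schwarz by simp
  also have "\<dots> = ip d x x * (lam * ip d y y)" by simp
  also have "\<dots> \<le> ip d x x * (N x)\<^sup>2"
    using wform_lower[of X a lam d y, OF a_nonneg] ip_nonneg y by (intro mult_left_mono) auto
  finally have "(N x)\<^sup>2 * (lam * (N x)\<^sup>2) \<le> (N x)\<^sup>2 * ip d x x"
    by (simp add: power2_eq_square mult_ac)
  then show ?thesis using ip_nonneg[of d x]
    by (cases "N x = 0") auto
qed

end

text \<open>Duality reverses comparisons: the Riesz representer for \<open>b\<close> is a test
  vector in \<open>dual_bound\<close> for \<open>a\<close>.\<close>

lemma wdual_antimono:
  assumes "weighted_form lam X a" "weighted_form lam X b" "0 \<le> c"
    and le: "\<And>u. u \<in> rvec d \<Longrightarrow> wform d lam X a u u \<le> c * wform d lam X b u u"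
  shows "(wdual d lam X b x)\<^sup>2 \<le> c * (wdual d lam X a x)\<^sup>2"
proof -
  interpret A: weighted_form d lam X a by fact
  interpret B: weighted_form d lam X b by fact
  obtain y where y: "y \<in> rvec d" "ip d x y = (B.N x)\<^sup>2" "B.Q y y = (B.N x)\<^sup>2"
    by (rule B.dual_attained)
  have "((B.N x)\<^sup>2)\<^sup>2 \<le> (A.N x)\<^sup>2 * A.Q y y"
    using A.dual_bound[OF y(1), of x] y by simp
  also have "\<dots> \<le> (A.N x)\<^sup>2 * (c * (B.N x)\<^sup>2)"
    using le[OF y(1)] y by (intro mult_left_mono) auto
  finally have "(B.N x)\<^sup>2 * (B.N x)\<^sup>2 \<le> (B.N x)\<^sup>2 * (c * (A.N x)\<^sup>2)"
    by (simp add: power2_eq_square mult_ac)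
  then have "B.N x \<noteq> 0 \<Longrightarrow> (B.N x)\<^sup>2 \<le> c * (A.N x)\<^sup>2"
    by (rule mult_left_le_imp_le) simp
  then show ?thesis using \<open>0 \<le> c\<close> by (cases "B.N x = 0") auto
qed


text \<open>A factor \<open>c\<close> between squared dual norms is a factor \<open>sqrt c\<close>
  between dual norms, and so between the new weights. Duality and the reciprocal both reverse the
  order, which is thus kept. The unchanged regulariser is absorbed by
  \<open>1 \<le> sqrt c\<close>.\<close>

lemma reweight_step:
  fixes \<nu> :: "vec \<Rightarrow> real"
  assumes a: "weighted_form lam X a" and b: "weighted_form lam X b" and "1 \<le> c"
    and \<nu>: "\<And>x. x \<in> X \<Longrightarrow> 0 \<le> \<nu> x"
    and lo: "\<And>u. u \<in> rvec d \<Longrightarrow> wform d lam X a u u \<le> wform d lam X b u u"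
    and hi: "\<And>u. u \<in> rvec d \<Longrightarrow> wform d lam X b u u \<le> c * wform d lam X a u u"
  defines "a' \<equiv> \<lambda>x. \<nu> x / wdual d lam X a x" and "b' \<equiv> \<lambda>x. \<nu> x / wdual d lam X b x"
  shows "wform d lam X a' u u \<le> wform d lam X b' u u \<and>
    wform d lam X b' u u \<le> sqrt c * wform d lam X a' u u"
proof -
  interpret A: weighted_form d lam X a by fact
  interpret B: weighted_form d lam X b by fact
  have ba: "B.N x \<le> A.N x" for x
    using wdual_antimono[OF a b, of 1 d x] lo A.wdual_nonneg[of x]
    by (auto intro: power2_le_imp_le)
  have ab: "A.N x \<le> sqrt c * B.N x" for x
  proof (rule power2_le_imp_le)
    show "(A.N x)\<^sup>2 \<le> (sqrt c * B.N x)\<^sup>2"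
      using wdual_antimono[OF b a, of c d x] hi \<open>1 \<le> c\<close> by (simp add: power_mult_distrib)
  qed (use \<open>1 \<le> c\<close> B.wdual_nonneg in simp)
  have bnds: "a' x \<le> b' x" "b' x \<le> sqrt c * a' x" if "x \<in> X" for x
  proof -
    have "a' x \<le> b' x \<and> b' x \<le> sqrt c * a' x"
    \<comment> \<open>If \<open>B.N x\<close> vanishes, so does \<open>A.N x\<close> by
      \<open>ab\<close>, and both weights are 0 because division by 0 yields 0.\<close>
    proof (cases "B.N x = 0")
      case True
      then show ?thesis using ab[of x] A.wdual_nonneg[of x] by (simp add: a'_def b'_def)
    next
      case False
      then have pos: "0 < B.N x" "0 < A.N x" using ba[of x] B.wdual_nonneg[of x] by auto
      have "\<nu> x * B.N x \<le> \<nu> x * A.N x" "\<nu> x * A.N x \<le> \<nu> x * (sqrt c * B.N x)"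
        using ab ba \<nu>[OF that] by (auto intro: mult_left_mono)
      then show ?thesis using pos by (simp add: a'_def b'_def field_simps)
    qed
    then show "a' x \<le> b' x" "b' x \<le> sqrt c * a' x" by auto
  qed
  have "wform d lam X b' u u \<le> sqrt c * (\<Sum>x\<in>X. a' x * (ip d x u)\<^sup>2) + lam * ip d u u"
    unfolding wform_self sum_distrib_left mult.assoc[symmetric]
    using bnds by (intro add_right_mono sum_mono mult_right_mono) auto
  also have "\<dots> \<le> sqrt c * (\<Sum>x\<in>X. a' x * (ip d x u)\<^sup>2) + sqrt c * (lam * ip d u u)"
    using \<open>1 \<le> c\<close> A.lam_pos ip_nonneg[of d u]
      mult_right_mono[of 1 "sqrt c" "lam * ip d u u"] by simp
  also have "\<dots> = sqrt c * wform d lam X a' u u"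
    by (simp add: wform_self distrib_left)
  finally show ?thesis using wform_mono[of X a' b' d lam u] bnds(1) by simp
qed

text \<open>A regularised Lewis change of density. Since the dual norm is the square root of a
  quadratic form, one reweighting replaces a distortion \<open>c\<close> by \<open>sqrt c\<close>.\<close>

lemma balanced_weights:
  fixes \<nu> :: "vec \<Rightarrow> real"
  assumes lam: "0 < lam" and X: "finite X" "\<And>x. x \<in> X \<Longrightarrow> ip d x x \<le> 1"
    and \<nu>: "\<And>x. x \<in> X \<Longrightarrow> 0 \<le> \<nu> x"
  obtains a where "weighted_form lam X a"
    "\<And>u. u \<in> rvec d \<Longrightarrow> wform d lam X a u u \<le> wform d lam X (\<lambda>x. \<nu> x / wdual d lam X a x) u u"
    "\<And>u. u \<in> rvec d \<Longrightarrow> wform d lam X (\<lambda>x. \<nu> x / wdual d lam X a x) u u \<le> 2 * wform d lam X a u u"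
proof -
  define F where "F a = (\<lambda>x. \<nu> x / wdual d lam X a x)" for a
  \<comment> \<open>From zero weights the first form is \<open>lam\<close> times the Euclidean one.
    It lies below the second form, so all later forms increase, and the first distortion is
    finite.\<close>
  define A where "A k = (F ^^ k) (\<lambda>_. 0)" for k
  have A_Suc: "A (Suc k) = F (A k)" for k by (simp add: A_def)
  have F: "weighted_form lam X (F a)" if "weighted_form lam X a" for a
  proof -
    interpret weighted_form d lam X a by fact
    show ?thesis using \<nu> wdual_nonneg by unfold_locales (auto simp: lam F_def)
  qed
  have A: "weighted_form lam X (A k)" for k
    by (induction k) (auto simp: A_Suc F, simp add: A_def weighted_form_def lam)
  define C where "C = 1 + (\<Sum>x\<in>X. A 1 x) / lam"
  have A1: "0 \<le> A 1 x" if "x \<in> X" for x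
    using A[of 1] that by (simp add: weighted_form_def)
  have C: "1 \<le> C" using lam A1 by (simp add: C_def sum_nonneg)
  have step: "wform d lam X (A k) u u \<le> wform d lam X (A (Suc k)) u u \<and>
      wform d lam X (A (Suc k)) u u \<le> (C powr ((1/2)^k)) * wform d lam X (A k) u u"
    if "u \<in> rvec d" for k u
    using that
  proof (induction k arbitrary: u)
    case 0
    have "(\<Sum>x\<in>X. A 1 x * (ip d x u)\<^sup>2) \<le> (\<Sum>x\<in>X. A 1 x * ip d u u)"
    proof (intro sum_mono mult_left_mono A1)
      fix x assume "x \<in> X"
      have "(ip d x u)\<^sup>2 \<le> ip d x x * ip d u u" by (rule ip_cauchy_schwarz)
      also have "\<dots> \<le> 1 * ip d u u"
        using X(2)[OF \<open>x \<in> X\<close>] ip_nonneg by (intro mult_right_mono)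
      finally show "(ip d x u)\<^sup>2 \<le> ip d u u" by simp
    qed
    then have "wform d lam X (A 1) u u \<le> C * (lam * ip d u u)"
      using lam unfolding wform_self C_def sum_distrib_right[symmetric] by (simp add: algebra_simps)
    moreover have "wform d lam X (A 0) u u = lam * ip d u u" by (simp add: wform_self A_def)
    moreover have "lam * ip d u u \<le> wform d lam X (A 1) u u"
      using A1 by (rule wform_lower)
    ultimately show ?case using C by simp
  next
    case (Suc k)
    have "1 \<le> C powr ((1/2)^k)" using C by (simp add: ge_one_powr_ge_zero)
    from reweight_step[OF A[of k] A[of "Suc k"] this \<nu>, where d = d and u = u] Suc.IH
    show ?case
      using C by (simp add: A_Suc F_def powr_half_sqrt_powr)
  qed
  \<comment> \<open>Repeated square roots bring any \<open>C\<close> below 2: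
    \<open>C < 2 ^ (2 ^ k)\<close>, and the \<open>2 ^ k\<close>-th root of the right side is
    2.\<close>
  obtain k where "C < 2^k" using real_arch_pow[of 2 C] by auto
  also have "(2::real)^k \<le> 2^(2^k)" by (intro power_increasing) auto
  also have "\<dots> = 2 powr (2^k)" using powr_realpow[of "2::real" "2^k"] by simp
  finally have "C powr ((1/2)^k) \<le> (2 powr (2^k)) powr ((1/2)^k)"
    using C by (intro powr_mono2) auto
  also have "\<dots> = 2" by (simp add: powr_powr power_one_over)
  finally have c2: "C powr ((1/2)^k) \<le> 2" .
  have "wform d lam X (A (Suc k)) u u \<le> 2 * wform d lam X (A k) u u" if "u \<in> rvec d" for u
  proof -
    interpret weighted_form d lam X "A k" by (rule A)
    show ?thesis using step[OF that, of k] mult_right_mono[OF c2 wform_nonneg[of u]] by linarith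
  qed
  with step show ?thesis using that[OF A[of k]] by (auto simp: A_Suc F_def)
qed

subsection \<open>The decision and its loss\<close>

lemma Pi_dec_iff: "\<theta> \<in> Pi_dec d \<longleftrightarrow> \<theta> \<in> rvec d \<and> ip d \<theta> \<theta> \<le> 1"
  by (simp add: Pi_dec_def vnorm_def)

lemma abs_ip_le_1:
  assumes "ip d x x \<le> 1" "ip d y y \<le> 1" shows "\<bar>ip d x y\<bar> \<le> 1"
proof -
  have "(ip d x y)\<^sup>2 \<le> 1"
    using ip_cauchy_schwarz[of d x y] mult_le_one[OF assms(1) ip_nonneg assms(2)] by linarith
  then show ?thesis by (simp add: abs_square_le_1)
qed

lemma Pi_dec_convex:
  assumes "u \<in> Pi_dec d" "v \<in> Pi_dec d" "0 \<le> s" "s \<le> 1"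
  shows "(\<lambda>i. (1 - s) * u i + s * v i) \<in> Pi_dec d"
proof -
  let ?w = "\<lambda>i. (1 - s) * u i + s * v i"
  have exp: "ip d ?w z = (1 - s) * ip d u z + s * ip d v z" for z
    unfolding ip_commute[of d ?w z] ip_lincomb by (simp add: ip_commute[of d z])
  have "ip d u u \<le> 1" "ip d v v \<le> 1" "ip d u v \<le> 1"
    using assms abs_ip_le_1[of d u v] by (auto simp: Pi_dec_iff)
  then have "(1 - s)\<^sup>2 * ip d u u + (2 * (s * (1 - s)) * ip d u v + s\<^sup>2 * ip d v v)
      \<le> (1 - s)\<^sup>2 * 1 + (2 * (s * (1 - s)) * 1 + s\<^sup>2 * 1)"
    using assms by (intro add_mono mult_left_mono) auto
  also have "\<dots> = 1" by (simp add: power2_eq_square algebra_simps)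
  also have "(1 - s)\<^sup>2 * ip d u u + (2 * (s * (1 - s)) * ip d u v + s\<^sup>2 * ip d v v) = ip d ?w ?w"
    unfolding exp ip_lincomb ip_commute[of d v u] by (simp add: power2_eq_square algebra_simps)
  finally show ?thesis using assms by (auto simp: Pi_dec_iff rvec_def)
qed

text \<open>In its application \<open>J\<close> is a weighted least squares objective without its
  constant term; the conclusion is first-order optimality over the unit ball, up to
  \<open>\<tau>\<close>. A near-minimiser is enough, which avoids a compactness argument.\<close>

lemma approx_least_squares:
  fixes \<rho> \<mu> :: "vec \<Rightarrow> real"
  assumes X: "finite X" "\<And>x. x \<in> X \<Longrightarrow> ip d x x \<le> 1"
    and \<rho>: "\<And>x. x \<in> X \<Longrightarrow> 0 \<le> \<rho> x" and "0 < \<tau>"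
  obtains \<theta>0 where "\<theta>0 \<in> Pi_dec d"
    "\<And>\<theta>. \<theta> \<in> Pi_dec d \<Longrightarrow> (\<Sum>x\<in>X. ip d x (\<theta> - \<theta>0) * (\<mu> x - \<rho> x * ip d x \<theta>0)) \<le> \<tau>"
proof -
  define J where "J \<theta> = (\<Sum>x\<in>X. \<rho> x * (ip d x \<theta>)\<^sup>2 - 2 * \<mu> x * ip d x \<theta>)" for \<theta>
  have ip1: "\<bar>ip d x \<theta>\<bar> \<le> 1" if "x \<in> X" "\<theta> \<in> Pi_dec d" for x \<theta>
    using abs_ip_le_1 X(2) that by (auto simp: Pi_dec_iff)
  have bdd: "bdd_below (J ` Pi_dec d)"
  proof (rule bdd_belowI2)
    fix \<theta> assume \<theta>: "\<theta> \<in> Pi_dec d"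
    show "(\<Sum>x\<in>X. - 2 * \<bar>\<mu> x\<bar>) \<le> J \<theta>"
      unfolding J_def
    proof (rule sum_mono)
      fix x assume x: "x \<in> X"
      have "\<mu> x * ip d x \<theta> \<le> \<bar>\<mu> x\<bar> * 1"
        using ip1[OF x \<theta>] mult_left_mono[of "\<bar>ip d x \<theta>\<bar>" 1 "\<bar>\<mu> x\<bar>"] abs_ge_self[of "\<mu> x * ip d x \<theta>"]
        by (simp add: abs_mult)
      moreover have "0 \<le> \<rho> x * (ip d x \<theta>)\<^sup>2" using \<rho>[OF x] by simp
      ultimately show "- 2 * \<bar>\<mu> x\<bar> \<le> \<rho> x * (ip d x \<theta>)\<^sup>2 - 2 * \<mu> x * ip d x \<theta>" by linarith
    qed
  qed
  define m where "m = Inf (J ` Pi_dec d)"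
  define K where "K = (\<Sum>x\<in>X. \<rho> x * 4)"
  have K: "0 \<le> K" using \<rho> by (simp add: K_def sum_nonneg)
  \<comment> \<open>A near-minimiser up to \<open>s\<^sup>2\<close>, compared with the point a
    fraction \<open>s\<close> of the way to \<open>\<theta>\<close>, gives
    \<open>2 * V < s * (1 + E)\<close>. As \<open>E \<le> K\<close>, this \<open>s\<close> makes the
    right side at most \<open>\<tau>\<close>.\<close>
  define s where "s = min 1 (\<tau> / (1 + K))"
  have s: "0 < s" "s \<le> 1" "s * (1 + K) \<le> \<tau>"
  proof -
    show "0 < s" "s \<le> 1" using K \<open>0 < \<tau>\<close> by (auto simp: s_def)
    have "s * (1 + K) \<le> \<tau> / (1 + K) * (1 + K)" using K by (intro mult_right_mono) (auto simp: s_def)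
    then show "s * (1 + K) \<le> \<tau>" using K by simp
  qed
  have "(\<lambda>_. 0) \<in> Pi_dec d" by (simp add: Pi_dec_iff rvec_def ip_def)
  then have "J ` Pi_dec d \<noteq> {}" by blast
  moreover have "Inf (J ` Pi_dec d) < m + s\<^sup>2" using s by (simp add: m_def)
  ultimately have "\<exists>z\<in>J ` Pi_dec d. z < m + s\<^sup>2" by (rule cInf_lessD)
  then obtain \<theta>0 where \<theta>0: "\<theta>0 \<in> Pi_dec d" "J \<theta>0 < m + s\<^sup>2" by blast
  have "(\<Sum>x\<in>X. ip d x (\<theta> - \<theta>0) * (\<mu> x - \<rho> x * ip d x \<theta>0)) \<le> \<tau>" if \<theta>: "\<theta> \<in> Pi_dec d" for \<theta>
  proof -
    define V where "V = (\<Sum>x\<in>X. ip d x (\<theta> - \<theta>0) * (\<mu> x - \<rho> x * ip d x \<theta>0))"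
    define E where "E = (\<Sum>x\<in>X. \<rho> x * (ip d x (\<theta> - \<theta>0))\<^sup>2)"
    have "E \<le> K" unfolding E_def K_def
    proof (intro sum_mono mult_left_mono)
      fix x assume x: "x \<in> X"
      have "\<bar>ip d x (\<theta> - \<theta>0)\<bar> \<le> 2" using ip1[OF x \<theta>] ip1[OF x \<theta>0(1)] by (simp add: ip_diff)
      then show "(ip d x (\<theta> - \<theta>0))\<^sup>2 \<le> 4" using abs_le_square_iff[of "ip d x (\<theta> - \<theta>0)" 2] by simp
    qed (use \<rho> in auto)
    let ?w = "\<lambda>i. (1 - s) * \<theta>0 i + s * \<theta> i"
    have "J \<theta>0 - s\<^sup>2 < m" using \<theta>0 by simp
    also have "m \<le> J ?w"
      unfolding m_def using Pi_dec_convex[OF \<theta>0(1) \<theta>, of s] s by (intro cInf_lower bdd) auto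
    also have "J ?w = J \<theta>0 - 2 * s * V + s\<^sup>2 * E"
      unfolding J_def V_def E_def sum_distrib_left sum_subtractf[symmetric] sum.distrib[symmetric]
      by (intro sum.cong refl, unfold ip_lincomb ip_diff) (simp add: power2_eq_square algebra_simps)
    finally have "s * (2 * V) < s * (s * (1 + E))" by (simp add: power2_eq_square algebra_simps)
    then have "2 * V < s * (1 + E)" using s by (simp only: mult_less_cancel_left_pos)
    also have "\<dots> \<le> s * (1 + K)" using \<open>E \<le> K\<close> s by (intro mult_left_mono) auto
    finally show ?thesis using s \<open>0 < \<tau>\<close> unfolding V_def[symmetric] by linarith
  qed
  with \<theta>0 show ?thesis using that by blast
qed

section \<open>Loss of the least squares decision\<close>

lemma cauchy_schwarz_sqrt:
  fixes f g :: "'a \<Rightarrow> real"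
  shows "\<bar>\<Sum>i\<in>I. f i * g i\<bar> \<le> sqrt (\<Sum>i\<in>I. (f i)\<^sup>2) * sqrt (\<Sum>i\<in>I. (g i)\<^sup>2)"
  using real_sqrt_le_mono[OF Cauchy_Schwarz_ineq_sum[of f g I]] by (simp add: real_sqrt_mult)

text \<open>\<open>\<nu>0\<close> and \<open>m0\<close> stand for the marginal and signed marginal
  of the reference, \<open>\<nu>\<close> and \<open>\<theta>\<close> for marginal and parameter of a
  model. The hypotheses compare labels, predictions of \<open>\<theta>0\<close>, and information
  matrices. The factor 12 is 3, for three families of queries, times 4, for rescaling them to
  \<open>[0, 1]\<close>.\<close>

lemma finite_reduction:
  fixes \<nu>0 m0 :: "vec \<Rightarrow> real"
  assumes X: "finite X" "X \<noteq> {}" "\<And>x. x \<in> X \<Longrightarrow> ip d x x \<le> 1"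
    and \<nu>0: "\<And>x. x \<in> X \<Longrightarrow> 0 \<le> \<nu>0 x" and \<epsilon>: "0 < \<epsilon>"
  obtains \<theta>0 p1 p2 r where "\<theta>0 \<in> Pi_dec d"
    "finite (set_pmf p1)" "\<And>g x. g \<in> set_pmf p1 \<Longrightarrow> \<bar>g x\<bar> \<le> 1"
    "finite (set_pmf p2)" "\<And>g x. g \<in> set_pmf p2 \<Longrightarrow> \<bar>g x\<bar> \<le> 1"
    "\<And>x. x \<in> X \<Longrightarrow> \<bar>r x\<bar> \<le> (1::real)"
    "\<And>\<nu> \<theta>. (\<And>x. x \<in> X \<Longrightarrow> 0 \<le> \<nu> x) \<Longrightarrow> \<theta> \<in> Pi_dec d \<Longrightarrow>
      measure_pmf.expectation p1 (\<lambda>g. (\<Sum>x\<in>X. (\<nu> x * ip d x \<theta> - m0 x) * g x)\<^sup>2) \<le> 12 * \<epsilon>\<^sup>2 \<Longrightarrow>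
      measure_pmf.expectation p1 (\<lambda>g. (\<Sum>x\<in>X. (\<nu> x - \<nu>0 x) * ip d x \<theta>0 * g x)\<^sup>2) \<le> 12 * \<epsilon>\<^sup>2 \<Longrightarrow>
      measure_pmf.expectation p2 (\<lambda>g. (\<Sum>x\<in>X. (\<nu> x - \<nu>0 x) * r x * g x)\<^sup>2) \<le> 12 * \<epsilon>\<^sup>2 \<Longrightarrow>
      (\<Sum>x\<in>X. \<nu> x * \<bar>ip d x (\<theta>0 - \<theta>)\<bar>) \<le> 200 * sqrt (real d) * \<epsilon>"
proof -
  \<comment> \<open>The square of the scale in \<open>r\<close>: \<open>wdual_le_norm\<close> then
    gives \<open>\<bar>r x\<bar> \<le> 1\<close>, and a query error of
    \<open>25 * \<epsilon>\<close> becomes an error of \<open>1 / 4\<close> in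
    \<open>F\<close>.\<close>
  define lam where "lam = (100 * \<epsilon>)\<^sup>2"
  have lam: "0 < lam" using \<epsilon> by (simp add: lam_def)
  obtain a where a: "weighted_form lam X a" and
    lo: "\<And>u. u \<in> rvec d \<Longrightarrow> wform d lam X a u u \<le> wform d lam X (\<lambda>x. \<nu>0 x / wdual d lam X a x) u u" and
    hi: "\<And>u. u \<in> rvec d \<Longrightarrow> wform d lam X (\<lambda>x. \<nu>0 x / wdual d lam X a x) u u \<le> 2 * wform d lam X a u u"
    using balanced_weights[of lam X d \<nu>0, OF lam X(1,3) \<nu>0] by blast
  interpret weighted_form d lam X a by (rule a)
  define w where "w x i = ip d x (e i) / N x" for x i
  have N_w: "N x * (\<Sum>i<d. (w x i)\<^sup>2) = N x" for x
  proof (cases "N x = 0")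
    case False
    have "(\<Sum>i<d. (w x i)\<^sup>2) = (N x)\<^sup>2 / (N x)\<^sup>2"
      unfolding wdual_sq sum_divide_distrib
      by (intro sum.cong refl) (simp only: w_def power_divide wdual_sq)
    then show ?thesis using False by simp
  qed simp
  have w1: "(\<Sum>i<d. (w x i)\<^sup>2) \<le> 1" for x
    by (cases "N x = 0") (use N_w[of x] in \<open>simp_all add: w_def\<close>)
  have ipN: "ip d x u / N x = (\<Sum>i<d. Q u (e i) * w x i)" if "u \<in> rvec d" for x u
    unfolding ip_expand[OF that, of x] w_def by (simp add: sum_divide_distrib)
  have ip0: "ip d x u = 0" if "N x = 0" "u \<in> rvec d" for x u
    using dual_bound[OF that(2), of x] that(1) by simp
  obtain p1 where p1: "finite (set_pmf p1)" "\<And>g x. g \<in> set_pmf p1 \<Longrightarrow> \<bar>g x\<bar> \<le> 1"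
    and p1_bd: "\<And>\<alpha>. (\<Sum>i<d. (\<Sum>x\<in>X. \<alpha> x * w x i)\<^sup>2) \<le> 49 * measure_pmf.expectation p1 (\<lambda>g. (\<Sum>x\<in>X. \<alpha> x * g x)\<^sup>2)"
    using sketch[OF X(1,2), of "{..<d}" w] w1 by auto
  have "(\<Sum>ij\<in>{..<d}\<times>{..<d}. (w x (fst ij) * w x (snd ij))\<^sup>2) \<le> 1" for x
  proof -
    have "(\<Sum>ij\<in>{..<d}\<times>{..<d}. (w x (fst ij) * w x (snd ij))\<^sup>2) = (\<Sum>i<d. (w x i)\<^sup>2) * (\<Sum>i<d. (w x i)\<^sup>2)"
      by (simp add: sum_product sum.cartesian_product power_mult_distrib case_prod_unfold)
    then show ?thesis using w1[of x] by (simp add: mult_le_one sum_nonneg)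
  qed
  then obtain p2 where p2: "finite (set_pmf p2)" "\<And>g x. g \<in> set_pmf p2 \<Longrightarrow> \<bar>g x\<bar> \<le> 1"
    and p2_bd: "\<And>\<alpha>. (\<Sum>ij\<in>{..<d}\<times>{..<d}. (\<Sum>x\<in>X. \<alpha> x * (w x (fst ij) * w x (snd ij)))\<^sup>2)
        \<le> 49 * measure_pmf.expectation p2 (\<lambda>g. (\<Sum>x\<in>X. \<alpha> x * g x)\<^sup>2)"
    using sketch[OF X(1,2), of "{..<d}\<times>{..<d}" "\<lambda>x ij. w x (fst ij) * w x (snd ij)"] by auto
  obtain \<theta>0 where \<theta>0: "\<theta>0 \<in> Pi_dec d" and ls: "\<And>\<theta>. \<theta> \<in> Pi_dec d \<Longrightarrow>
      (\<Sum>x\<in>X. ip d x (\<theta> - \<theta>0) * (m0 x / N x - \<nu>0 x / N x * ip d x \<theta>0)) \<le> \<epsilon>\<^sup>2"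
    using approx_least_squares[of X d "\<lambda>x. \<nu>0 x / N x" "\<epsilon>\<^sup>2" "\<lambda>x. m0 x / N x"] X(1,3) \<nu>0 \<epsilon> wdual_nonneg
    by auto
  define r where "r x = 100 * \<epsilon> * N x" for x
  have r1: "\<bar>r x\<bar> \<le> 1" if "x \<in> X" for x
  proof -
    have "(r x)\<^sup>2 \<le> 1"
      using wdual_le_norm[of x] X(3)[OF that] by (simp add: r_def lam_def power_mult_distrib)
    then show ?thesis by (simp add: abs_square_le_1)
  qed
  have "(\<Sum>x\<in>X. \<nu> x * \<bar>ip d x (\<theta>0 - \<theta>)\<bar>) \<le> 200 * sqrt (real d) * \<epsilon>"
    if \<nu>: "\<And>x. x \<in> X \<Longrightarrow> 0 \<le> \<nu> x" and \<theta>: "\<theta> \<in> Pi_dec d"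
      and q1: "measure_pmf.expectation p1 (\<lambda>g. (\<Sum>x\<in>X. (\<nu> x * ip d x \<theta> - m0 x) * g x)\<^sup>2) \<le> 12 * \<epsilon>\<^sup>2"
      and q2: "measure_pmf.expectation p1 (\<lambda>g. (\<Sum>x\<in>X. (\<nu> x - \<nu>0 x) * ip d x \<theta>0 * g x)\<^sup>2) \<le> 12 * \<epsilon>\<^sup>2"
      and q3: "measure_pmf.expectation p2 (\<lambda>g. (\<Sum>x\<in>X. (\<nu> x - \<nu>0 x) * r x * g x)\<^sup>2) \<le> 12 * \<epsilon>\<^sup>2"
    for \<nu> \<theta>
  proof -
    define \<delta> where "\<delta> = \<theta> - \<theta>0"
    have \<delta>: "\<delta> \<in> rvec d" using \<theta> \<theta>0 by (auto simp: \<delta>_def Pi_dec_def rvec_def)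
    define c where "c i = Q \<delta> (e i)" for i
    define q where "q = Q \<delta> \<delta>"
    have q: "q = (\<Sum>i<d. (c i)\<^sup>2)" "0 \<le> q"
      unfolding q_def c_def by (rule parseval[OF \<delta>], rule wform_nonneg)
    have wc: "ip d x \<delta> / N x = (\<Sum>i<d. c i * w x i)" for x
      unfolding c_def by (rule ipN[OF \<delta>])
    define G where "G i = (\<Sum>x\<in>X. (\<nu> x * ip d x \<theta> - m0 x) * w x i)" for i
    define H where "H i = (\<Sum>x\<in>X. (\<nu> x - \<nu>0 x) * ip d x \<theta>0 * w x i)" for i
    \<comment> \<open>The difference of the information matrices of model and reference in the basis
      \<open>e\<close>, with weights \<open>1 / N\<close>.\<close>
    define F where "F ij = (\<Sum>x\<in>X. (\<nu> x - \<nu>0 x) * N x * (w x (fst ij) * w x (snd ij)))" for ij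
    \<comment> \<open>The 49 of the sketch times the 12 of the hypotheses is
      \<open>588 \<le> 25\<^sup>2\<close>.\<close>
    have sqrt_bd: "sqrt S \<le> 25 * \<epsilon>" if "S \<le> 49 * (12 * \<epsilon>\<^sup>2)" for S
    proof -
      have "S \<le> (25 * \<epsilon>)\<^sup>2" using that by (simp add: power_mult_distrib) (use zero_le_power2[of \<epsilon>] in linarith)
      then show ?thesis using \<epsilon> by (simp add: real_le_lsqrt)
    qed
    have G: "sqrt (\<Sum>i<d. (G i)\<^sup>2) \<le> 25 * \<epsilon>"
      using p1_bd[of "\<lambda>x. \<nu> x * ip d x \<theta> - m0 x"] q1 by (intro sqrt_bd) (simp add: G_def)
    have H: "sqrt (\<Sum>i<d. (H i)\<^sup>2) \<le> 25 * \<epsilon>"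
      using p1_bd[of "\<lambda>x. (\<nu> x - \<nu>0 x) * ip d x \<theta>0"] q2 by (intro sqrt_bd) (simp add: H_def)
    have F: "sqrt (\<Sum>ij\<in>{..<d}\<times>{..<d}. (F ij)\<^sup>2) \<le> 1/4"
    proof -
      have "(\<Sum>x\<in>X. (\<nu> x - \<nu>0 x) * r x * (w x (fst ij) * w x (snd ij))) = 100 * \<epsilon> * F ij" for ij
        by (simp add: F_def r_def sum_distrib_left mult_ac)
      then have "sqrt (\<Sum>ij\<in>{..<d}\<times>{..<d}. (100 * \<epsilon> * F ij)\<^sup>2) \<le> 25 * \<epsilon>"
        using p2_bd[of "\<lambda>x. (\<nu> x - \<nu>0 x) * r x"] q3 by (intro sqrt_bd) simp
      then have "100 * \<epsilon> * sqrt (\<Sum>ij\<in>{..<d}\<times>{..<d}. (F ij)\<^sup>2) \<le> 100 * \<epsilon> * (1/4)"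
        using \<epsilon> by (simp add: power_mult_distrib real_sqrt_mult flip: sum_distrib_left)
      then show ?thesis using \<epsilon> by (simp only: mult_le_cancel_left_pos mult_pos_pos zero_less_numeral)
    qed
    define \<beta> where "\<beta> = (\<Sum>x\<in>X. \<nu> x / N x * (ip d x \<delta>)\<^sup>2)"
    define V where "V = (\<Sum>x\<in>X. ip d x \<delta> * (m0 x / N x - \<nu>0 x / N x * ip d x \<theta>0))"
    have V: "V \<le> \<epsilon>\<^sup>2" unfolding V_def \<delta>_def by (rule ls[OF \<theta>])
    \<comment> \<open>Label error, minus prediction error, plus the residual of the normal equations
      at \<open>\<theta>0\<close>. The queries control the first two, near-optimality the
      last.\<close>
    have "\<beta> = (\<Sum>x\<in>X. (\<nu> x * ip d x \<theta> - m0 x) * (ip d x \<delta> / N x))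
        - (\<Sum>x\<in>X. (\<nu> x - \<nu>0 x) * ip d x \<theta>0 * (ip d x \<delta> / N x)) + V"
      unfolding \<beta>_def V_def sum_subtractf[symmetric] sum.distrib[symmetric]
    proof (intro sum.cong refl)
      fix x
      have "ip d x \<theta> = ip d x \<theta>0 + ip d x \<delta>" by (simp add: \<delta>_def ip_diff)
      then show "\<nu> x / N x * (ip d x \<delta>)\<^sup>2 = (\<nu> x * ip d x \<theta> - m0 x) * (ip d x \<delta> / N x)
          - (\<nu> x - \<nu>0 x) * ip d x \<theta>0 * (ip d x \<delta> / N x)
          + ip d x \<delta> * (m0 x / N x - \<nu>0 x / N x * ip d x \<theta>0)"
        by (cases "N x = 0") (simp_all add: field_simps power2_eq_square)
    qed
    also have "(\<Sum>x\<in>X. (\<nu> x * ip d x \<theta> - m0 x) * (ip d x \<delta> / N x)) = (\<Sum>i<d. c i * G i)"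
      unfolding wc G_def by (simp add: sum_distrib_left mult_ac sum.swap[of _ X])
    also have "(\<Sum>x\<in>X. (\<nu> x - \<nu>0 x) * ip d x \<theta>0 * (ip d x \<delta> / N x)) = (\<Sum>i<d. c i * H i)"
      unfolding wc H_def by (simp add: sum_distrib_left mult_ac sum.swap[of _ X])
    finally have \<beta>_eq: "\<beta> = (\<Sum>i<d. c i * G i) - (\<Sum>i<d. c i * H i) + V" .
    have "\<bar>\<Sum>i<d. c i * G i\<bar> \<le> sqrt q * (25 * \<epsilon>)" "\<bar>\<Sum>i<d. c i * H i\<bar> \<le> sqrt q * (25 * \<epsilon>)"
      using cauchy_schwarz_sqrt[of c G "{..<d}"] mult_left_mono[OF G, of "sqrt q"]
        cauchy_schwarz_sqrt[of c H "{..<d}"] mult_left_mono[OF H, of "sqrt q"]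
      unfolding q(1)[symmetric] using q(2) by auto
    with V have \<beta>_le: "\<beta> \<le> \<epsilon>\<^sup>2 + 50 * \<epsilon> * sqrt q" unfolding \<beta>_eq by (simp add: mult_ac)
    \<comment> \<open>Reference and model differ along \<open>\<delta>\<close> by the quadratic form
      of \<open>F\<close>, which is at most its Frobenius norm times \<open>q\<close>.\<close>
    have "(\<Sum>x\<in>X. \<nu>0 x / N x * (ip d x \<delta>)\<^sup>2) - \<beta> \<le> q / 4"
    proof -
      have "\<beta> - (\<Sum>x\<in>X. \<nu>0 x / N x * (ip d x \<delta>)\<^sup>2) = (\<Sum>x\<in>X. (\<nu> x - \<nu>0 x) * N x * (ip d x \<delta> / N x)\<^sup>2)"
        unfolding \<beta>_def sum_subtractf[symmetric]
      proof (intro sum.cong refl)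
        fix x
        show "\<nu> x / N x * (ip d x \<delta>)\<^sup>2 - \<nu>0 x / N x * (ip d x \<delta>)\<^sup>2
          = (\<nu> x - \<nu>0 x) * N x * (ip d x \<delta> / N x)\<^sup>2"
          by (cases "N x = 0") (simp_all add: field_simps power2_eq_square)
      qed
      also have "\<dots> = (\<Sum>ij\<in>{..<d}\<times>{..<d}. (c (fst ij) * c (snd ij)) * F ij)"
      proof -
        have "(ip d x \<delta> / N x)\<^sup>2 = (\<Sum>ij\<in>{..<d}\<times>{..<d}. (c (fst ij) * c (snd ij)) * (w x (fst ij) * w x (snd ij)))" for x
          unfolding wc power2_eq_square sum_product sum.cartesian_product
          by (intro sum.cong) (auto simp: mult_ac)
        then show ?thesis unfolding F_def by (simp add: sum_distrib_left mult_ac sum.swap[of _ X])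
      qed
      finally have *: "\<beta> - (\<Sum>x\<in>X. \<nu>0 x / N x * (ip d x \<delta>)\<^sup>2) =
        (\<Sum>ij\<in>{..<d}\<times>{..<d}. (c (fst ij) * c (snd ij)) * F ij)" .
      have "(\<Sum>ij\<in>{..<d}\<times>{..<d}. (c (fst ij) * c (snd ij))\<^sup>2) = q * q"
        unfolding q(1) sum_product sum.cartesian_product
        by (simp add: power_mult_distrib case_prod_unfold)
      then have "\<bar>\<Sum>ij\<in>{..<d}\<times>{..<d}. (c (fst ij) * c (snd ij)) * F ij\<bar> \<le> q * (1/4)"
        using cauchy_schwarz_sqrt[of "\<lambda>ij. c (fst ij) * c (snd ij)" F "{..<d}\<times>{..<d}"]
          mult_left_mono[OF F q(2)] q(2) by (simp add: real_sqrt_mult)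
      then show ?thesis unfolding *[symmetric] by linarith
    qed
    moreover have "q \<le> (\<Sum>x\<in>X. \<nu>0 x / N x * (ip d x \<delta>)\<^sup>2) + lam * ip d \<delta> \<delta>"
      using lo[OF \<delta>] unfolding q_def wform_self[of _ _ _ "\<lambda>x. \<nu>0 x / N x"] .
    moreover have "lam * ip d \<delta> \<delta> \<le> 40000 * \<epsilon>\<^sup>2"
    proof -
      have "\<bar>ip d \<theta> \<theta>0\<bar> \<le> 1" "ip d \<theta> \<theta> \<le> 1" "ip d \<theta>0 \<theta>0 \<le> 1"
        using \<theta> \<theta>0 abs_ip_le_1[of d \<theta> \<theta>0] by (auto simp: Pi_dec_iff)
      then have "ip d \<delta> \<delta> \<le> 4"
        by (simp add: \<delta>_def ip_diff ip_commute[of d "_ - _"] ip_commute[of d \<theta>0 \<theta>])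
      then show ?thesis using mult_left_mono[of "ip d \<delta> \<delta>" 4 lam] lam
        by (simp add: lam_def power_mult_distrib)
    qed
    \<comment> \<open>The lower balance \<open>lo\<close> bounds \<open>q\<close> by the reference
      information plus the regulariser, at most \<open>100\<^sup>2 * 4 * \<epsilon>\<^sup>2\<close>
      as \<open>\<delta>\<close> has norm at most 2. The extra 1 is the least squares slack.\<close>
    ultimately have "3/4 * q \<le> 40001 * \<epsilon>\<^sup>2 + 50 * \<epsilon> * sqrt q" using \<beta>_le by linarith
    moreover have "50 * \<epsilon> * sqrt q \<le> q / 4 + 2500 * \<epsilon>\<^sup>2"
      using zero_le_power2[of "sqrt q / 2 - 50 * \<epsilon>"] q(2) by (simp add: power2_diff power_mult_distrib power_divide mult.commute)
    \<comment> \<open>Absorbing the linear term leaves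
      \<open>q / 2 \<le> 42501 * \<epsilon>\<^sup>2\<close>, and
      \<open>85002 \<le> 292\<^sup>2\<close>.\<close>
    ultimately have "q \<le> (292 * \<epsilon>)\<^sup>2"
    proof -
      have "(292 * \<epsilon>)\<^sup>2 = 85264 * \<epsilon>\<^sup>2" by (simp add: power_mult_distrib)
      then show "3/4 * q \<le> 40001 * \<epsilon>\<^sup>2 + 50 * \<epsilon> * sqrt q \<Longrightarrow>
        50 * \<epsilon> * sqrt q \<le> q / 4 + 2500 * \<epsilon>\<^sup>2 \<Longrightarrow> ?thesis"
        using zero_le_power2[of \<epsilon>] by linarith
    qed
    then have "sqrt q \<le> 292 * \<epsilon>" using \<epsilon> by (simp add: real_le_lsqrt q)
    then have "50 * \<epsilon> * sqrt q \<le> 50 * \<epsilon> * (292 * \<epsilon>)" using \<epsilon> by (intro mult_left_mono) auto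
    with \<beta>_le have \<beta>_bd: "\<beta> \<le> 14601 * \<epsilon>\<^sup>2" by (simp add: power2_eq_square)
    \<comment> \<open>The mean of \<open>N\<close> is the trace of the information matrix of the
      model. Each diagonal entry is at most 2 for the reference, by the upper balance
      \<open>hi\<close>, plus at most \<open>1 / 4\<close> from \<open>F\<close>.\<close>
    have T: "(\<Sum>x\<in>X. \<nu> x * N x) \<le> 9/4 * real d"
    proof -
      have "(\<Sum>x\<in>X. \<nu> x * N x) = (\<Sum>x\<in>X. \<nu> x * (N x * (\<Sum>i<d. (w x i)\<^sup>2)))" by (simp only: N_w)
      also have "\<dots> = (\<Sum>i<d. \<Sum>x\<in>X. \<nu> x * N x * (w x i)\<^sup>2)"
        by (simp add: sum_distrib_left mult_ac sum.swap[of _ X])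
      also have "\<dots> = (\<Sum>i<d. F (i, i) + (\<Sum>x\<in>X. \<nu>0 x / N x * (ip d x (e i))\<^sup>2))"
      proof (intro sum.cong refl)
        fix i
        have "N x * (w x i)\<^sup>2 = (ip d x (e i))\<^sup>2 / N x" for x
          by (cases "N x = 0") (simp_all add: w_def power2_eq_square)
        then show "(\<Sum>x\<in>X. \<nu> x * N x * (w x i)\<^sup>2) = F (i, i) + (\<Sum>x\<in>X. \<nu>0 x / N x * (ip d x (e i))\<^sup>2)"
          unfolding F_def sum.distrib[symmetric]
          by (intro sum.cong refl) (simp add: power2_eq_square algebra_simps diff_divide_distrib)
      qed
      also have "\<dots> \<le> (\<Sum>i<d. 1/4 + 2)"
      proof (intro sum_mono add_mono)
        fix i assume "i \<in> {..<d}" then have i: "i < d" by simp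
        have "(F (i, i))\<^sup>2 \<le> (\<Sum>ij\<in>{..<d}\<times>{..<d}. (F ij)\<^sup>2)"
          using i by (intro member_le_sum) auto
        then have "\<bar>F (i, i)\<bar> \<le> 1/4" using F real_sqrt_le_mono by fastforce
        then show "F (i, i) \<le> 1/4" by simp
        have "(\<Sum>x\<in>X. \<nu>0 x / N x * (ip d x (e i))\<^sup>2) \<le> wform d lam X (\<lambda>x. \<nu>0 x / N x) (e i) (e i)"
          unfolding wform_self using lam ip_nonneg[of d "e i"] by simp
        also have "\<dots> \<le> 2 * Q (e i) (e i)" by (rule hi[OF basis_in[OF i]])
        also have "\<dots> = 2" by (simp add: basis_orth i)
        finally show "(\<Sum>x\<in>X. \<nu>0 x / N x * (ip d x (e i))\<^sup>2) \<le> 2" .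
      qed
      finally show ?thesis by simp
    qed
    \<comment> \<open>Set up for Cauchy-Schwarz, which separates the trace from
      \<open>\<beta>\<close>; where \<open>N x = 0\<close> both sides vanish.\<close>
    have "(\<Sum>x\<in>X. \<nu> x * \<bar>ip d x (\<theta>0 - \<theta>)\<bar>) = (\<Sum>x\<in>X. sqrt (\<nu> x * N x) * (sqrt (\<nu> x / N x) * \<bar>ip d x \<delta>\<bar>))"
    proof (intro sum.cong refl)
      fix x assume x: "x \<in> X"
      have flip_sign: "\<bar>ip d x (\<theta>0 - \<theta>)\<bar> = \<bar>ip d x \<delta>\<bar>" by (simp add: \<delta>_def ip_diff)
      show "\<nu> x * \<bar>ip d x (\<theta>0 - \<theta>)\<bar> = sqrt (\<nu> x * N x) * (sqrt (\<nu> x / N x) * \<bar>ip d x \<delta>\<bar>)"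
      proof (cases "N x = 0")
        case True
        then show ?thesis using ip0[OF _ \<delta>, of x] flip_sign by simp
      next
        case False
        have "sqrt (\<nu> x * N x) * sqrt (\<nu> x / N x) = sqrt ((\<nu> x)\<^sup>2)"
          using False by (simp add: power2_eq_square flip: real_sqrt_mult)
        then have "sqrt (\<nu> x * N x) * sqrt (\<nu> x / N x) = \<nu> x" using \<nu>[OF x] by simp
        then show ?thesis unfolding flip_sign by (simp only: mult.assoc[symmetric])
      qed
    qed
    also have "\<dots> \<le> sqrt (\<Sum>x\<in>X. (sqrt (\<nu> x * N x))\<^sup>2) * sqrt (\<Sum>x\<in>X. (sqrt (\<nu> x / N x) * \<bar>ip d x \<delta>\<bar>)\<^sup>2)"
      by (rule abs_le_D1[OF cauchy_schwarz_sqrt])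
    also have "(\<Sum>x\<in>X. (sqrt (\<nu> x * N x))\<^sup>2) = (\<Sum>x\<in>X. \<nu> x * N x)"
      using \<nu> wdual_nonneg by (intro sum.cong) auto
    also have "(\<Sum>x\<in>X. (sqrt (\<nu> x / N x) * \<bar>ip d x \<delta>\<bar>)\<^sup>2) = \<beta>"
      unfolding \<beta>_def using \<nu> wdual_nonneg by (intro sum.cong) (auto simp: power_mult_distrib)
    also have "sqrt (\<Sum>x\<in>X. \<nu> x * N x) * sqrt \<beta> \<le> sqrt (9/4 * real d) * sqrt (14601 * \<epsilon>\<^sup>2)"
    proof (intro mult_mono real_sqrt_le_mono T \<beta>_bd)
      show "0 \<le> sqrt \<beta>" unfolding \<beta>_def using \<nu> wdual_nonneg by (simp add: sum_nonneg)
    qed simp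
    also have "\<dots> = sqrt (9/4 * 14601) * sqrt (real d) * \<epsilon>"
      using \<epsilon> by (simp only: real_sqrt_mult real_sqrt_abs) simp
    also have "\<dots> \<le> 200 * sqrt (real d) * \<epsilon>"
      using \<epsilon> by (intro mult_right_mono real_le_lsqrt) auto
    finally show ?thesis .
  qed
  then show ?thesis using that[of \<theta>0 p1 p2 r] \<theta>0 p1 p2 r1 by blast
qed

subsection \<open>Private queries\<close>

text \<open>Affine on \<open>[-1, 1]\<close>, the only range that matters on \<open>Zsp X\<close>.
  The truncation is there because \<open>Lfun\<close> asks for bounds at all points, also where the
  argument is uncontrolled.\<close>

definition clip :: "real \<Rightarrow> real" where
  "clip t = max 0 (min 1 ((1 + t) / 2))"

lemma clip_bounds: "0 \<le> clip t" "clip t \<le> 1"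
  by (auto simp: clip_def)

lemma clip_eq: "\<bar>t\<bar> \<le> 1 \<Longrightarrow> clip t = (1 + t) / 2"
  by (auto simp: clip_def)

definition marg :: "obs pmf \<Rightarrow> vec \<Rightarrow> real" where
  "marg M x = pmf M (x, 1) + pmf M (x, -1)"

text \<open>The mean of the label restricted to the covariate \<open>x\<close>. Being linear in the
  distribution, it suits mixtures as well as linear models.\<close>

definition signed_marg :: "obs pmf \<Rightarrow> vec \<Rightarrow> real" where
  "signed_marg M x = pmf M (x, 1) - pmf M (x, -1)"

section \<open>Models on a finite set of covariates\<close>

context
  fixes d :: nat and X :: "vec set"
  assumes X: "finite X" "\<And>x. x \<in> X \<Longrightarrow> ip d x x \<le> 1"
begin

lemma expectation_Zsp:
  assumes M: "set_pmf M \<subseteq> Zsp X"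
  shows "measure_pmf.expectation M f = (\<Sum>x\<in>X. pmf M (x, 1) * f (x, 1) + pmf M (x, -1) * f (x, -1))"
proof -
  have "measure_pmf.expectation M f = (\<Sum>z\<in>X \<times> {-1, 1}. f z * pmf M z)"
    using M X(1) by (intro integral_measure_pmf_real) (auto simp: Zsp_def)
  also have "\<dots> = (\<Sum>x\<in>X. \<Sum>y\<in>{-1, 1}. f (x, y) * pmf M (x, y))"
    by (simp only: sum.cartesian_product) (simp add: case_prod_unfold)
  finally show ?thesis by (simp add: algebra_simps)
qed

lemma marg_nonneg: "0 \<le> marg M x"
  by (simp add: marg_def)

lemma pmf_map_fst_Zsp:
  assumes M: "set_pmf M \<subseteq> Zsp X"
  shows "pmf (map_pmf fst M) x = marg M x"
proof -
  have "pmf (map_pmf fst M) x = measure (measure_pmf M) (fst -` {x})" by (simp add: pmf_map)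
  also have "\<dots> = measure (measure_pmf M) ((fst -` {x}) \<inter> set_pmf M)"
    by (simp add: measure_Int_set_pmf)
  also have "\<dots> = measure (measure_pmf M) ({(x, 1), (x, -1)} \<inter> set_pmf M)"
    using M by (intro arg_cong[where f = "measure _"]) (auto simp: Zsp_def)
  also have "\<dots> = marg M x"
    by (simp add: measure_Int_set_pmf measure_measure_pmf_finite marg_def)
  finally show ?thesis .
qed

lemma sum_marg:
  assumes M: "set_pmf M \<subseteq> Zsp X" shows "(\<Sum>x\<in>X. marg M x) = 1"
  using expectation_Zsp[OF M, of "\<lambda>_. 1"] by (simp add: marg_def)

text \<open>Clearing the denominator of the conditional mean gives an identity at every
  \<open>x\<close>; off the support both sides are 0.\<close>

lemma signed_marg_eq:
  assumes M: "set_pmf M \<subseteq> Zsp X" and \<theta>: "is_param d M \<theta>"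
  shows "signed_marg M x = marg M x * ip d x \<theta>"
proof (cases "x \<in> fst ` set_pmf M")
  case False
  then have "pmf M (x, 1) = 0" "pmf M (x, -1) = 0"
    by (auto simp: pmf_eq_0_set_pmf image_iff)
  then show ?thesis by (simp add: signed_marg_def marg_def)
next
  case True
  let ?A = "{z. fst z = x}"
  have ne: "set_pmf M \<inter> ?A \<noteq> {}" using True by auto
  have meas: "measure (measure_pmf M) ?A = marg M x"
    using pmf_map_fst_Zsp[OF M, of x] by (simp add: pmf_map vimage_def)
  have "pmf (map_pmf fst M) x > 0" using True by (intro pmf_positive) simp
  then have pos: "marg M x > 0" by (simp add: pmf_map_fst_Zsp[OF M])
  have "set_pmf (cond_pmf M ?A) \<subseteq> {(x, 1), (x, -1)}"
    using M by (auto simp: set_cond_pmf[OF ne] Zsp_def)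
  then have "cond_mean M x = (\<Sum>z\<in>{(x, 1), (x, -1)}. snd z * pmf (cond_pmf M ?A) z)"
    unfolding cond_mean_def by (intro integral_measure_pmf_real) auto
  also have "\<dots> = signed_marg M x / marg M x"
    by (simp add: pmf_cond[OF ne] meas signed_marg_def diff_divide_distrib)
  finally have "cond_mean M x * marg M x = signed_marg M x" using pos by simp
  moreover have "cond_mean M x = ip d x \<theta>" using \<theta> True by (auto simp: is_param_def)
  ultimately show ?thesis by (simp add: mult.commute)
qed

lemma theta_of_param:
  assumes "M \<in> M_Lin d X" shows "is_param d M (theta_of d M)"
proof -
  have "\<exists>\<theta>. is_param d M \<theta>" using assms by (simp add: M_Lin_def)
  then show ?thesis unfolding theta_of_def by (rule someI_ex)
qed

lemma L1_eq:
  assumes "M \<in> M_Lin d X"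
  shows "L1 d M \<theta> = (\<Sum>x\<in>X. marg M x * \<bar>ip d x (\<theta> - theta_of d M)\<bar>)"
proof -
  have M: "set_pmf M \<subseteq> Zsp X" using assms by (simp add: M_Lin_def)
  show ?thesis unfolding L1_def integral_map_pmf expectation_Zsp[OF M]
    by (simp add: marg_def algebra_simps)
qed

text \<open>These bounds make the loss integrable under any \<open>p\<close> on the unit ball and
  the suprema of real numbers meaningful.\<close>

lemma L1_le_2:
  assumes M: "M \<in> M_Lin d X" and \<theta>: "\<theta> \<in> Pi_dec d" shows "0 \<le> L1 d M \<theta>" "L1 d M \<theta> \<le> 2"
proof -
  show "0 \<le> L1 d M \<theta>" unfolding L1_eq[OF M] by (simp add: sum_nonneg marg_nonneg)
  have M': "set_pmf M \<subseteq> Zsp X" using M by (simp add: M_Lin_def)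
  have "L1 d M \<theta> \<le> (\<Sum>x\<in>X. marg M x * 2)"
    unfolding L1_eq[OF M]
  proof (intro sum_mono mult_left_mono marg_nonneg)
    fix x assume "x \<in> X"
    then have "\<bar>ip d x \<theta>\<bar> \<le> 1" "\<bar>ip d x (theta_of d M)\<bar> \<le> 1"
      using \<theta> theta_of_param[OF M] X(2) by (auto simp: Pi_dec_iff is_param_def intro: abs_ip_le_1)
    then show "\<bar>ip d x (\<theta> - theta_of d M)\<bar> \<le> 2" by (simp add: ip_diff)
  qed
  also have "\<dots> = 2" using sum_marg[OF M'] by (simp flip: sum_distrib_right)
  finally show "L1 d M \<theta> \<le> 2" .
qed

text \<open>The constant \<open>1 / 2\<close> in \<open>clip\<close> contributes equally to both
  distributions and cancels; its slope \<open>1 / 2\<close> is squared.\<close>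

lemma Dl_clip:
  assumes M: "set_pmf M \<subseteq> Zsp X" and Mb: "set_pmf Mb \<subseteq> Zsp X"
    and t: "\<And>x. x \<in> X \<Longrightarrow> \<bar>t (x, 1)\<bar> \<le> 1 \<and> \<bar>t (x, -1)\<bar> \<le> 1"
  shows "(Dl (\<lambda>z. clip (t z)) M Mb)\<^sup>2 = (\<Sum>x\<in>X. (pmf M (x, 1) - pmf Mb (x, 1)) * t (x, 1)
      + (pmf M (x, -1) - pmf Mb (x, -1)) * t (x, -1))\<^sup>2 / 4"
proof -
  let ?S = "\<lambda>M. (\<Sum>x\<in>X. pmf M (x, 1) * t (x, 1) + pmf M (x, -1) * t (x, -1))"
  have E: "measure_pmf.expectation M (\<lambda>z. clip (t z)) = 1/2 + ?S M / 2"
    if "set_pmf M \<subseteq> Zsp X" for M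
  proof -
    have "measure_pmf.expectation M (\<lambda>z. clip (t z)) =
        (\<Sum>x\<in>X. marg M x / 2 + (pmf M (x, 1) * t (x, 1) + pmf M (x, -1) * t (x, -1)) / 2)"
      unfolding expectation_Zsp[OF that] using t
      by (intro sum.cong refl) (simp add: clip_eq marg_def field_simps)
    also have "\<dots> = 1/2 + ?S M / 2"
      using sum_marg[OF that] by (simp add: sum.distrib flip: sum_divide_distrib)
    finally show ?thesis .
  qed
  have "(Dl (\<lambda>z. clip (t z)) M Mb)\<^sup>2 = (?S M / 2 - ?S Mb / 2)\<^sup>2"
    unfolding Dl_def E[OF M] E[OF Mb] by simp
  also have "?S M / 2 - ?S Mb / 2 = (\<Sum>x\<in>X. (pmf M (x, 1) - pmf Mb (x, 1)) * t (x, 1)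
      + (pmf M (x, -1) - pmf Mb (x, -1)) * t (x, -1)) / 2"
    unfolding diff_divide_distrib[symmetric] sum_subtractf[symmetric]
    by (intro arg_cong[where f = "\<lambda>s. s / 2"] sum.cong refl) (simp add: algebra_simps)
  finally show ?thesis by (simp add: power_divide)
qed

lemma private_queries:
  assumes Mb: "set_pmf Mb \<subseteq> Zsp X" and \<epsilon>: "0 < \<epsilon>"
  obtains \<theta>0 q where "\<theta>0 \<in> Pi_dec d" "set_pmf q \<subseteq> Lfun"
    "\<And>M. M \<in> M_Lin d X \<Longrightarrow> measure_pmf.expectation q (\<lambda>l. (Dl l M Mb)\<^sup>2) \<le> \<epsilon>\<^sup>2 \<Longrightarrow>
      L1 d M \<theta>0 \<le> 200 * sqrt (real d) * \<epsilon>"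
proof -
  have "X \<noteq> {}" using Mb set_pmf_not_empty[of Mb] by (auto simp: Zsp_def)
  from finite_reduction[where ?\<nu>0.0 = "marg Mb" and ?m0.0 = "signed_marg Mb", OF X(1) this X(2) marg_nonneg \<epsilon>]
  obtain \<theta>0 p1 p2 r where \<theta>0: "\<theta>0 \<in> Pi_dec d"
    and p1: "finite (set_pmf p1)" "\<And>g x. g \<in> set_pmf p1 \<Longrightarrow> \<bar>g x\<bar> \<le> 1"
    and p2: "finite (set_pmf p2)" "\<And>g x. g \<in> set_pmf p2 \<Longrightarrow> \<bar>g x\<bar> \<le> 1"
    and r: "\<And>x. x \<in> X \<Longrightarrow> \<bar>r x\<bar> \<le> (1::real)"
    and loss: "\<And>\<nu> \<theta>. (\<And>x. x \<in> X \<Longrightarrow> 0 \<le> \<nu> x) \<Longrightarrow> \<theta> \<in> Pi_dec d \<Longrightarrow>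
      measure_pmf.expectation p1 (\<lambda>g. (\<Sum>x\<in>X. (\<nu> x * ip d x \<theta> - signed_marg Mb x) * g x)\<^sup>2) \<le> 12 * \<epsilon>\<^sup>2 \<Longrightarrow>
      measure_pmf.expectation p1 (\<lambda>g. (\<Sum>x\<in>X. (\<nu> x - marg Mb x) * ip d x \<theta>0 * g x)\<^sup>2) \<le> 12 * \<epsilon>\<^sup>2 \<Longrightarrow>
      measure_pmf.expectation p2 (\<lambda>g. (\<Sum>x\<in>X. (\<nu> x - marg Mb x) * r x * g x)\<^sup>2) \<le> 12 * \<epsilon>\<^sup>2 \<Longrightarrow>
      (\<Sum>x\<in>X. \<nu> x * \<bar>ip d x (\<theta>0 - \<theta>)\<bar>) \<le> 200 * sqrt (real d) * \<epsilon>"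
    by blast
  define l1 where "l1 g = (\<lambda>z::obs. clip (snd z * g (fst z)))" for g
  define l2 where "l2 g = (\<lambda>z::obs. clip (ip d (fst z) \<theta>0 * g (fst z)))" for g
  define l3 where "l3 g = (\<lambda>z::obs. clip (r (fst z) * g (fst z)))" for g
  have fin: "finite (set_pmf (map_pmf l1 p1))" "finite (set_pmf (map_pmf l2 p1))"
    "finite (set_pmf (map_pmf l3 p2))" using p1 p2 by auto
  obtain q' where q': "finite (set_pmf q')" "set_pmf q' \<subseteq> set_pmf (map_pmf l2 p1) \<union> set_pmf (map_pmf l3 p2)"
    "\<And>f :: (obs \<Rightarrow> real) \<Rightarrow> real. measure_pmf.expectation q' f = 1/2 * measure_pmf.expectation (map_pmf l2 p1) f
       + (1 - 1/2) * measure_pmf.expectation (map_pmf l3 p2) f"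
    by (rule pmf_mix[OF fin(2,3), of "1/2"], simp, simp) (rule that; assumption)
  \<comment> \<open>Weight \<open>1 / 3\<close> here and \<open>1 / 2\<close> inside
    \<open>q'\<close> give each of the three families weight \<open>1 / 3\<close>. The terms being
    nonnegative, each is bounded separately later.\<close>
  obtain q where q: "set_pmf q \<subseteq> set_pmf (map_pmf l1 p1) \<union> set_pmf q'"
    "\<And>f :: (obs \<Rightarrow> real) \<Rightarrow> real. measure_pmf.expectation q f = 1/3 * measure_pmf.expectation (map_pmf l1 p1) f
       + (1 - 1/3) * measure_pmf.expectation q' f"
    by (rule pmf_mix[OF fin(1) q'(1), of "1/3"], simp, simp) (rule that; assumption)
  have "set_pmf q \<subseteq> Lfun"
  proof -
    have "l1 g \<in> Lfun" "l2 g \<in> Lfun" "l3 g \<in> Lfun" for g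
      by (simp_all add: Lfun_def l1_def l2_def l3_def clip_bounds)
    then have "set_pmf (map_pmf l1 p1) \<union> (set_pmf (map_pmf l2 p1) \<union> set_pmf (map_pmf l3 p2)) \<subseteq> Lfun"
      by auto
    then show ?thesis using q(1) q'(2) by blast
  qed
  moreover have "L1 d M \<theta>0 \<le> 200 * sqrt (real d) * \<epsilon>"
    if M: "M \<in> M_Lin d X" and qle: "measure_pmf.expectation q (\<lambda>l. (Dl l M Mb)\<^sup>2) \<le> \<epsilon>\<^sup>2" for M
  proof -
    have M': "set_pmf M \<subseteq> Zsp X" using M by (simp add: M_Lin_def)
    note par = theta_of_param[OF M]
    have prod: "\<bar>u * v\<bar> \<le> 1" if "\<bar>u\<bar> \<le> 1" "\<bar>v\<bar> \<le> 1" for u v :: real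
      using that by (simp add: abs_mult mult_le_one)
    have D1: "(Dl (l1 g) M Mb)\<^sup>2 =
        (\<Sum>x\<in>X. (marg M x * ip d x (theta_of d M) - signed_marg Mb x) * g x)\<^sup>2 / 4"
      if "g \<in> set_pmf p1" for g
      unfolding l1_def
      by (subst Dl_clip[OF M' Mb]) (use p1(2)[OF that] in
          \<open>simp_all add: signed_marg_eq[OF M' par, symmetric] signed_marg_def algebra_simps\<close>)
    have D2: "(Dl (l2 g) M Mb)\<^sup>2 = (\<Sum>x\<in>X. (marg M x - marg Mb x) * ip d x \<theta>0 * g x)\<^sup>2 / 4"
      if "g \<in> set_pmf p1" for g
      unfolding l2_def
      by (subst Dl_clip[OF M' Mb]) (use p1(2)[OF that] \<theta>0 X(2) in
          \<open>auto intro!: prod abs_ip_le_1 simp: Pi_dec_iff marg_def algebra_simps\<close>)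
    have D3: "(Dl (l3 g) M Mb)\<^sup>2 = (\<Sum>x\<in>X. (marg M x - marg Mb x) * r x * g x)\<^sup>2 / 4"
      if "g \<in> set_pmf p2" for g
      unfolding l3_def
      by (subst Dl_clip[OF M' Mb]) (use p2(2)[OF that] r in
          \<open>auto intro!: prod simp: marg_def algebra_simps\<close>)
    let ?E1 = "measure_pmf.expectation p1 (\<lambda>g. (\<Sum>x\<in>X. (marg M x * ip d x (theta_of d M) - signed_marg Mb x) * g x)\<^sup>2)"
    let ?E2 = "measure_pmf.expectation p1 (\<lambda>g. (\<Sum>x\<in>X. (marg M x - marg Mb x) * ip d x \<theta>0 * g x)\<^sup>2)"
    let ?E3 = "measure_pmf.expectation p2 (\<lambda>g. (\<Sum>x\<in>X. (marg M x - marg Mb x) * r x * g x)\<^sup>2)"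
    have quarter: "measure_pmf.expectation (map_pmf l p) (\<lambda>l. (Dl l M Mb)\<^sup>2) = measure_pmf.expectation p G / 4"
      if "\<And>g. g \<in> set_pmf p \<Longrightarrow> (Dl (l g) M Mb)\<^sup>2 = G g / 4"
      for p :: "(vec \<Rightarrow> real) pmf" and l and G :: "(vec \<Rightarrow> real) \<Rightarrow> real"
    proof -
      have "measure_pmf.expectation p (\<lambda>g. (Dl (l g) M Mb)\<^sup>2) = measure_pmf.expectation p (\<lambda>g. G g / 4)"
        using that by (intro integral_cong_AE) (auto simp: AE_measure_pmf_iff)
      then show ?thesis by simp
    qed
    have "measure_pmf.expectation (map_pmf l1 p1) (\<lambda>l. (Dl l M Mb)\<^sup>2) = ?E1 / 4"
      "measure_pmf.expectation (map_pmf l2 p1) (\<lambda>l. (Dl l M Mb)\<^sup>2) = ?E2 / 4"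
      "measure_pmf.expectation (map_pmf l3 p2) (\<lambda>l. (Dl l M Mb)\<^sup>2) = ?E3 / 4"
      by (rule quarter, erule D1 D2 D3)+
    moreover have mixture: "1 / 3 * u + (1 - 1 / 3) * (1 / 2 * v + (1 - 1 / 2) * w) = (u + v + w) / 3"
      for u v w :: real by (simp add: field_simps)
    ultimately have "?E1 / 12 + ?E2 / 12 + ?E3 / 12 \<le> \<epsilon>\<^sup>2"
      using qle unfolding q(2) q'(3) mixture by (simp add: add_divide_distrib del: integral_map_pmf)
    moreover have "0 \<le> ?E1" "0 \<le> ?E2" "0 \<le> ?E3" by (auto intro!: integral_nonneg)
    ultimately have "?E1 \<le> 12 * \<epsilon>\<^sup>2" "?E2 \<le> 12 * \<epsilon>\<^sup>2" "?E3 \<le> 12 * \<epsilon>\<^sup>2" by linarith+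
    then show ?thesis
      unfolding L1_eq[OF M] using par by (intro loss marg_nonneg) (auto simp: is_param_def)
  qed
  ultimately show ?thesis using that \<theta>0 by blast
qed

text \<open>A point mass at \<open>\<theta>0\<close> with the queries above bounds the infimum for
  positive radius. At radius 0 the queries of a radius \<open>\<epsilon>'\<close> tending to 0 are
  used.\<close>

lemma pdec_at_le:
  assumes Mb: "set_pmf Mb \<subseteq> Zsp X" and "0 \<le> \<epsilon>"
  shows "pdec_at d X \<epsilon> Mb \<le> 200 * sqrt (real d) * \<epsilon>"
proof -
  define S where "S p q = insert 0 {measure_pmf.expectation p (L1 d M) | M. M \<in> M_Lin d X \<and>
          measure_pmf.expectation q (\<lambda>l. (Dl l M Mb)\<^sup>2) \<le> \<epsilon>\<^sup>2}" for p q
  have S_bdd: "bdd_above (S p q)" if "set_pmf p \<subseteq> Pi_dec d" for p q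
  proof (rule bdd_aboveI)
    fix v assume "v \<in> S p q"
    then consider "v = 0" | M where "M \<in> M_Lin d X" "v = measure_pmf.expectation p (L1 d M)"
      by (auto simp: S_def)
    then show "v \<le> 2"
    proof cases
      case (2 M)
      have ae: "AE \<theta> in measure_pmf p. L1 d M \<theta> \<le> 2"
        using that L1_le_2[OF 2(1)] by (auto simp: AE_measure_pmf_iff)
      have "integrable (measure_pmf p) (L1 d M)"
        using that L1_le_2[OF 2(1)]
        by (intro measure_pmf.integrable_const_bound[where B = 2]) (auto simp: AE_measure_pmf_iff)
      then show ?thesis using measure_pmf.integral_le_const[OF _ ae] 2 by simp
    qed simp
  qed
  have at: "pdec_at d X \<epsilon> Mb = Inf {Sup (S p q) | p q. set_pmf p \<subseteq> Pi_dec d \<and> set_pmf q \<subseteq> Lfun}"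
    by (simp add: pdec_at_def S_def)
  \<comment> \<open>The inserted 0 makes every supremum nonnegative.\<close>
  have bdd: "bdd_below {Sup (S p q) | p q. set_pmf p \<subseteq> Pi_dec d \<and> set_pmf q \<subseteq> Lfun}"
    by (rule bdd_belowI[of _ 0]) (auto simp: S_def[symmetric] intro!: cSup_upper S_bdd, simp add: S_def)
  \<comment> \<open>Enlarging the radius only admits more models, so the decision for
    \<open>\<epsilon>'\<close> also serves \<open>\<epsilon>\<close>.\<close>
  have main: "pdec_at d X \<epsilon> Mb \<le> 200 * sqrt (real d) * \<epsilon>'" if "\<epsilon> \<le> \<epsilon>'" "0 < \<epsilon>'" for \<epsilon>'
  proof -
    obtain \<theta>0 q where q: "\<theta>0 \<in> Pi_dec d" "set_pmf q \<subseteq> Lfun"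
      and loss: "\<And>M. M \<in> M_Lin d X \<Longrightarrow> measure_pmf.expectation q (\<lambda>l. (Dl l M Mb)\<^sup>2) \<le> \<epsilon>'\<^sup>2 \<Longrightarrow>
        L1 d M \<theta>0 \<le> 200 * sqrt (real d) * \<epsilon>'"
      using private_queries[OF Mb \<open>0 < \<epsilon>'\<close>] by blast
    have "\<epsilon>\<^sup>2 \<le> \<epsilon>'\<^sup>2" using that \<open>0 \<le> \<epsilon>\<close> by (intro power_mono)
    have "pdec_at d X \<epsilon> Mb \<le> Sup (S (return_pmf \<theta>0) q)"
      unfolding at
      by (intro cInf_lower bdd CollectI exI[of _ "return_pmf \<theta>0"] exI[of _ q]) (use q in auto)
    also have "\<dots> \<le> 200 * sqrt (real d) * \<epsilon>'"
    proof (rule cSup_least)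
      fix v assume "v \<in> S (return_pmf \<theta>0) q"
      then show "v \<le> 200 * sqrt (real d) * \<epsilon>'"
        using loss \<open>\<epsilon>\<^sup>2 \<le> \<epsilon>'\<^sup>2\<close> \<open>0 < \<epsilon>'\<close> by (auto simp: S_def)
    qed (simp add: S_def)
    finally show ?thesis .
  qed
  show ?thesis
  proof (cases "\<epsilon> = 0")
    case True
    show ?thesis
    proof (rule field_le_epsilon)
      fix \<eta> :: real assume "0 < \<eta>"
      define K where "K = 200 * sqrt (real d)"
      have K: "0 \<le> K" by (simp add: K_def)
      have "0 < \<eta> / (K + 1)" using K \<open>0 < \<eta>\<close> by simp
      then have "pdec_at d X \<epsilon> Mb \<le> K * (\<eta> / (K + 1))"
        using main[of "\<eta> / (K + 1)", folded K_def] True by simp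
      also have "\<dots> \<le> \<eta>" using K \<open>0 < \<eta>\<close> by (simp add: field_simps)
      finally show "pdec_at d X \<epsilon> Mb \<le> 200 * sqrt (real d) * \<epsilon> + \<eta>" using True by simp
    qed
  qed (use main[of \<epsilon>] \<open>0 \<le> \<epsilon>\<close> in auto)
qed

end

theorem theorem5p7:
  shows "\<exists>C>0. \<forall>d::nat. \<forall>X::vec set. \<forall>\<epsilon>::real.
           d \<ge> 1 \<and> finite X \<and> X \<subseteq> {x \<in> rvec d. vnorm d x \<le> 1} \<and> 0 \<le> \<epsilon> \<and> \<epsilon> \<le> 1
           \<longrightarrow> pdec d X \<epsilon> \<le> C * sqrt (real d) * \<epsilon>"
proof (intro exI[of _ 200] conjI allI impI)
  fix d :: nat and X :: "vec set" and \<epsilon> :: real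
  assume asm: "d \<ge> 1 \<and> finite X \<and> X \<subseteq> {x \<in> rvec d. vnorm d x \<le> 1} \<and> 0 \<le> \<epsilon> \<and> \<epsilon> \<le> 1"
  have X: "ip d x x \<le> 1" if "x \<in> X" for x
    using asm that by (auto simp: vnorm_def)
  have "pdec_at d X \<epsilon> Mb \<le> 200 * sqrt (real d) * \<epsilon>" if "Mb \<in> co_pmf (M_Lin d X)" for Mb
  proof (rule pdec_at_le)
    \<comment> \<open>The support of a mixture is the union of the supports of its
      components.\<close>
    show "set_pmf Mb \<subseteq> Zsp X"
      using that by (fastforce simp: co_pmf_def M_Lin_def set_bind_pmf join_pmf_def)
  qed (use asm X in auto)
  then show "pdec d X \<epsilon> \<le> 200 * sqrt (real d) * \<epsilon>"
    unfolding pdec_def using asm by (intro cSup_least) auto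
qed simp

end
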